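(* Let $n$ be a positive odd integer and let $N=(n-1)/2$ or $N=n-1$. Then \begin{align*} \sum_{k=0}^{N} (-1)^k q^{k^2} [4k+1]\frac{(q;q^2)_k^3}{(q^2;q^2)_k^3} &\equiv (-1)^{(n-1)/2}q^{(1-n^2)/4} \left(q^{\binom{n}{2}}[n]+\frac{(n^2-1)(1-q)^2}{24}[n]^3\right) \\ &\quad+[n]^3\sum_{k=1}^{(n-1)/2}\frac{q^k (q^2;q^2)_{k}}{[2k][2k-1](q;q^2)_{k}} \pmod{[n]\Phi_n(q)^3}. \end{align*}
   Context: Here $q$ is an indeterminate. The $q$-integer is $[m]=1+q+\cdots+q^{m-1}$. The $q$-shifted factorial is $(a;q)_0=1$ and $(a;q)_m=(1-a)(1-aq)\cdots(1-aq^{m-1})$ for $m\geq 1$. $\Phi_n(q)$ denotes the $n$-th cyclotomic polynomial, $\Phi_n(q)=\prod_{1\le k\le n,\ \gcd(k,n)=1}(q-\zeta^k)$ with $\zeta$ a primitive $n$-th root of unity. For rational functions $A(q),B(q)$ and a polynomial $P(q)\in\mathbb{Z}[q]$, $A(q)\equiv B(q)\pmod{P(q)}$ means that $P(q)$ divides the numerator of the reduced form of $A(q)-B(q)$ in $\mathbb{Z}[q]$. An empty sum equals $0$. *)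

theory Defs
  imports
    "HOL-Computational_Algebra.Computational_Algebra"
    "HOL-Number_Theory.Totient"
    Complex_Main
begin

text \<open>
  Rational functions are fractions of integer polynomials.  This field is the same as the
  field of fractions of rational polynomials, so rational coefficients are covered.
\<close>

type_synonym ratfun = "int poly fract"

abbreviation qpoly :: "int poly" where
  "qpoly \<equiv> [:0, 1:]"

abbreviation qfun :: ratfun where
  "qfun \<equiv> to_fract qpoly"

definition qint :: "'a::comm_semiring_1 \<Rightarrow> nat \<Rightarrow> 'a" where
  "qint q m = (\<Sum>i<m. q ^ i)"

definition qpoch :: "'a::comm_ring_1 \<Rightarrow> 'a \<Rightarrow> nat \<Rightarrow> 'a" where
  "qpoch a q m = (\<Prod>i<m. 1 - a * q ^ i)"

definition cyclotomic_complex :: "nat \<Rightarrow> complex poly" where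
  "cyclotomic_complex n = (\<Prod>k\<in>totatives n. [:- (cis (2 * pi / real n) ^ k), 1:])"

text \<open>
  \<open>cyclotomic_complex n\<close> has integer coefficients, and \<open>cyclotomic n\<close> is the same polynomial
  over the integers; that the description is well defined is lemma \<open>map_poly_cyclotomic\<close>.
\<close>

definition cyclotomic :: "nat \<Rightarrow> int poly" where
  "cyclotomic n = (THE p. map_poly of_int p = cyclotomic_complex n)"

text \<open>
  \<open>quot_of_fract\<close> returns numerator and denominator of the reduced form.
\<close>

definition ratfun_cong :: "ratfun \<Rightarrow> ratfun \<Rightarrow> int poly \<Rightarrow> bool" where
  "ratfun_cong A B P \<longleftrightarrow> P dvd fst (quot_of_fract (A - B))"


subsection \<open>Integrality of the cyclotomic polynomials\<close>

abbreviation (input) cpoly :: "int poly \<Rightarrow> complex poly" where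
  "cpoly \<equiv> map_poly of_int"

lemma cpoly_inj: "cpoly p = cpoly p' \<Longrightarrow> p = p'"
  by (simp add: poly_eq_iff coeff_map_poly)

lemma cpoly_add: "cpoly (p + p') = cpoly p + cpoly p'"
  by (simp add: poly_eq_iff coeff_map_poly)

lemma cpoly_mult: "cpoly (p * p') = cpoly p * cpoly p'"
  by (simp add: poly_eq_iff coeff_map_poly coeff_mult)

lemma cpoly_prod: "cpoly (\<Prod>i\<in>I. f i) = (\<Prod>i\<in>I. cpoly (f i))"
  by (induction I rule: infinite_finite_induct) (simp_all add: cpoly_mult)

lemma degree_cpoly: "degree (cpoly p) = degree p"
  by (rule degree_map_poly) simp

lemma lead_coeff_cyclotomic_complex: "lead_coeff (cyclotomic_complex n) = 1"
  by (simp add: cyclotomic_complex_def lead_coeff_prod)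

lemma prod_roots_unity:
  assumes "n > 0"
  shows "(\<Prod>k\<in>{0<..n}. [:- (cis (2 * pi / real n) ^ k), 1:]) = monom 1 n - 1"
proof -
  let ?z = "cis (2 * pi / real n)"
  have z: "?z ^ n = 1"
    using assms by (simp add: DeMoivre)
  have bij: "bij_betw (\<lambda>k. ?z ^ k) {..<n} {z. z ^ n = 1}"
    using bij_betw_roots_unity [OF assms] by (simp add: DeMoivre mult_ac)
  have "(\<Prod>k\<in>{0<..n}. [:- (?z ^ k), 1:]) = (\<Prod>k<n. [:- (?z ^ k), 1:])"
    by (rule prod.reindex_bij_witness
          [where i = "\<lambda>k. if k = 0 then n else k" and j = "\<lambda>k. if k = n then 0 else k"])
      (use assms z in auto)
  also have "\<dots> = (\<Prod>z\<in>{z. z ^ n = 1}. [:- z, 1:])"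
    by (rule prod.reindex_bij_betw [OF bij])
  also have "\<dots> = monom 1 n - 1"
  proof (rule poly_eqI_degree_lead_coeff [where n = n and A = "{z. z ^ n = 1}"])
    let ?P = "\<Prod>z\<in>{z. z ^ n = 1}. [:- z, 1:] :: complex poly"
    have deg: "degree ?P = n"
      by (subst degree_prod_eq_sum_degree) (simp_all add: card_roots_unity_eq [OF assms])
    have lc: "lead_coeff ?P = 1"
      by (simp add: lead_coeff_prod)
    show "coeff ?P n = coeff (monom 1 n - 1) n"
      using lc deg assms by (simp add: coeff_1)
    show "degree ?P \<le> n"
      using deg by simp
    show "degree (monom 1 n - 1 :: complex poly) \<le> n"
      by (intro degree_diff_le) (simp_all add: degree_monom_le)
    show "n \<le> card {z :: complex. z ^ n = 1}"
      by (simp add: card_roots_unity_eq [OF assms])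
    show "poly ?P z = poly (monom 1 n - 1) z" if "z \<in> {z. z ^ n = 1}" for z
      using that finite_roots_unity [of n] assms
      by (auto simp: poly_prod poly_monom intro!: prod_zero)
  qed
  finally show ?thesis .
qed

lemma prod_cyclotomic_complex:
  assumes "n > 0"
  shows "(\<Prod>d | d dvd n. cyclotomic_complex d) = monom 1 n - 1"
proof -
  let ?z = "\<lambda>n. cis (2 * pi / real n)"
  let ?A = "\<lambda>d. {k\<in>{0<..n}. gcd k n = d}"
  have "monom 1 n - 1 = (\<Prod>k\<in>{0<..n}. [:- (?z n ^ k), 1:])"
    by (rule prod_roots_unity [OF assms, symmetric])
  also have "{0<..n} = (\<Union>d\<in>{d. d dvd n}. ?A d)"
    by auto
  also have "(\<Prod>k\<in>\<dots>. [:- (?z n ^ k), 1:]) = (\<Prod>d | d dvd n. \<Prod>k\<in>?A d. [:- (?z n ^ k), 1:])"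
    using assms by (intro prod.UNION_disjoint) auto
  also have "\<dots> = (\<Prod>d | d dvd n. cyclotomic_complex (n div d))"
  proof (intro prod.cong refl)
    fix d assume "d \<in> {d. d dvd n}"
    then have d: "d dvd n" by simp
    have "(\<Prod>k\<in>?A d. [:- (?z n ^ k), 1:]) = (\<Prod>k\<in>totatives (n div d). [:- (?z n ^ (k * d)), 1:])"
      by (rule prod.reindex_bij_betw [OF bij_betw_totatives_gcd_eq [OF d assms], symmetric])
    also have "\<dots> = cyclotomic_complex (n div d)"
      unfolding cyclotomic_complex_def
      using d assms by (intro prod.cong refl) (auto simp: DeMoivre elim!: dvdE)
    finally show "(\<Prod>k\<in>?A d. [:- (?z n ^ k), 1:]) = cyclotomic_complex (n div d)" .
  qed
  also have "\<dots> = (\<Prod>d | d dvd n. cyclotomic_complex d)"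
    using assms by (intro prod.reindex_bij_witness [of _ "(div) n" "(div) n"]) (auto elim: dvdE)
  finally show ?thesis ..
qed

lemma cyclotomic_complex_integral: "\<exists>p. cpoly p = cyclotomic_complex n"
proof (induction n rule: less_induct)
  case (less n)
  show ?case
  proof (cases "n = 0")
    case True
    then have "cpoly 1 = cyclotomic_complex n"
      by (simp add: cyclotomic_complex_def)
    then show ?thesis by blast
  next
    case False
    define D where "D = {d. d dvd n \<and> d \<noteq> n}"
    have D: "{d. d dvd n} = insert n D" "n \<notin> D" "finite D"
      using False by (auto simp: D_def)
    have "\<exists>f. \<forall>d\<in>D. cpoly (f d) = cyclotomic_complex d"
    proof (intro bchoice ballI less.IH)
      show "d < n" if "d \<in> D" for d
        using that False by (auto simp: D_def dest!: dvd_imp_le)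
    qed
    then obtain f where f: "cpoly (f d) = cyclotomic_complex d" if "d \<in> D" for d
      by blast
    define g where "g = (\<Prod>d\<in>D. f d)"
    have g: "cpoly g = (\<Prod>d\<in>D. cyclotomic_complex d)"
      by (simp add: g_def cpoly_prod f)
    have "lead_coeff (cpoly g) = 1"
      by (simp add: g lead_coeff_prod lead_coeff_cyclotomic_complex)
    then have lc: "lead_coeff g = 1"
      by (simp add: degree_cpoly coeff_map_poly)
    then have "g \<noteq> 0" by auto
    obtain p r where pr: "pseudo_divmod (monom 1 n - 1) g = (p, r)"
      by fastforce
    have eq: "monom 1 n - 1 = g * p + r" and r: "r = 0 \<or> degree r < degree g"
      using pseudo_divmod [OF \<open>g \<noteq> 0\<close> pr] lc by simp_all
    have "cpoly (monom 1 n - 1) = monom 1 n - 1"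
      by (simp add: poly_eq_iff coeff_map_poly)
    also have "\<dots> = cpoly g * cyclotomic_complex n"
      using prod_cyclotomic_complex [of n] False D by (simp add: g mult.commute)
    finally have "cpoly r = cpoly g * (cyclotomic_complex n - cpoly p)"
      by (simp add: eq cpoly_add cpoly_mult algebra_simps)
    moreover have "cpoly g \<noteq> 0"
      using \<open>lead_coeff (cpoly g) = 1\<close> by auto
    ultimately have "cyclotomic_complex n - cpoly p = 0"
      using r by (metis add_lessD1 degree_cpoly degree_mult_eq less_irrefl map_poly_0 mult_eq_0_iff)
    then show ?thesis
      by (metis eq_iff_diff_eq_0)
  qed
qed

lemma map_poly_cyclotomic: "map_poly of_int (cyclotomic n) = cyclotomic_complex n"
proof -
  have "\<exists>!p. cpoly p = cyclotomic_complex n"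
    using cyclotomic_complex_integral cpoly_inj by metis
  then show ?thesis
    unfolding cyclotomic_def by (rule theI')
qed

end

theory Submission
  imports Defs
begin

text \<open>
  The summand extends to a \<open>q\<close>-WZ pair \<open>F(k,l)\<close>, \<open>G(k,l)\<close> with
  \<open>F(k,l) - F(k,l+1) = G(k+1,l+1) - G(k,l+1)\<close>.  With \<open>n = 2 m + 1\<close>, summing over \<open>k, l \<le> m\<close> gives the exact identity
  \<open>\<Sum>\<^sub>k F(k,0) = F(m,m) + \<Sum>\<^sub>l G(m+1,l)\<close>.  At a primitive \<open>n\<close>-th root of unity every \<open>G(m+1,l)\<close> vanishes to
  order three, with leading term the \<open>l\<close>-th summand on the right-hand side, while \<open>F(m,m)\<close> is a product of factors
  \<open>(1 - q\<^sup>n\<^sup>-\<^sup>2\<^sup>j) (1 - q\<^sup>n\<^sup>+\<^sup>2\<^sup>j)\<close>, equal to \<open>- q\<^sup>n\<^sup>-\<^sup>2\<^sup>j (1 - q\<^sup>2\<^sup>j)\<^sup>2\<close> up to a correction of relative order \<open>(1 - q\<^sup>n)\<^sup>2\<close>; the resulting sum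
  \<open>\<Sum>\<^sub>j w\<^sup>2\<^sup>j / (1 - w\<^sup>2\<^sup>j)\<^sup>2\<close> equals \<open>- (n\<^sup>2 - 1) / 24\<close>.  The terms with \<open>m < k < n\<close> vanish to
  order three and cancel to leading order under \<open>k \<mapsto> n + m - k\<close>.  At a root of unity of smaller order \<open>d\<close> the sum
  splits into blocks of length \<open>d\<close> which vanish separately.  Divisibility is read off from limits of complex functions.
\<close>

section \<open>A \<open>q\<close>-WZ pair\<close>

lemma qpoch_0 [simp]: "qpoch a q 0 = 1"
  by (simp add: qpoch_def)

lemma power2_mult_power: "q^2 * (q^2) ^ k = (q :: 'a::comm_ring_1) ^ (2*k+2)"
  by (metis add.commute power_add power_mult)

lemma qpoch_odd_Suc: "qpoch q (q^2) (Suc k) = qpoch q (q^2) k * (1 - q ^ (2*k+1))"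
  by (simp add: qpoch_def power_mult)

lemma qpoch_even_Suc: "qpoch (q^2) (q^2) (Suc k) = qpoch (q^2) (q^2) k * (1 - q ^ (2*k+2))"
  by (simp add: qpoch_def power2_mult_power del: power_Suc add_2_eq_Suc')

lemma qpoch_odd_prod: "qpoch q (q^2) k = (\<Prod>i<k. 1 - q ^ (2*i+1))"
  by (simp add: qpoch_def power_mult)

lemma qpoch_even_prod: "qpoch (q^2) (q^2) k = (\<Prod>i<k. 1 - q ^ (2*i+2))"
  by (simp add: qpoch_def power2_mult_power del: power_Suc add_2_eq_Suc')

text \<open>The value \<open>0\<close> for \<open>k < l\<close> stands for the convention \<open>1 / (q\<^sup>2;q\<^sup>2)\<^sub>k\<^sub>-\<^sub>l = 0\<close>.\<close>

definition wz_F :: "'a::field \<Rightarrow> nat \<Rightarrow> nat \<Rightarrow> 'a" where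
  "wz_F q k l = (if k < l then 0 else
     (-1) ^ (k - l) * q ^ ((k - l)^2) * (1 - q ^ (4*k+1)) * qpoch q (q^2) k ^ 2 * qpoch q (q^2) (k + l)
     / (qpoch (q^2) (q^2) k ^ 2 * qpoch (q^2) (q^2) (k - l) * qpoch q (q^2) l ^ 2))"

text \<open>Used only for positive \<open>l\<close>: then \<open>k\<close> is positive in the second
  branch, so both truncated subtractions are exact, and \<open>wz_G q 0 l\<close> is zero by the
  first branch.\<close>

definition wz_G :: "'a::field \<Rightarrow> nat \<Rightarrow> nat \<Rightarrow> 'a" where
  "wz_G q k l = (if k < l then 0 else
     (-1) ^ (k - l) * q ^ ((k - l)^2) * qpoch q (q^2) k ^ 2 * qpoch q (q^2) (k + l - 1)
     / (qpoch (q^2) (q^2) (k - 1) ^ 2 * qpoch (q^2) (q^2) (k - l) * qpoch q (q^2) l ^ 2))"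

lemma qpoch_odd_nz:
  fixes q :: "'a::field"
  assumes "\<And>j. 0 < j \<Longrightarrow> j < 2 * k \<Longrightarrow> q ^ j \<noteq> 1"
  shows "qpoch q (q^2) k \<noteq> 0"
  using assms by (force simp: qpoch_odd_prod)

lemma qpoch_even_nz:
  fixes q :: "'a::field"
  assumes "\<And>j. 0 < j \<Longrightarrow> j \<le> 2 * k \<Longrightarrow> q ^ j \<noteq> 1"
  shows "qpoch (q^2) (q^2) k \<noteq> 0"
proof -
  have "1 - q ^ (2*i+2) \<noteq> 0" if "i < k" for i
    using assms [of "2*i+2"] that by simp
  then show ?thesis by (simp add: qpoch_even_prod)
qed

text \<open>The WZ equation off the diagonal as a rational identity. For
  \<open>k = l + 1 + i\<close> it is applied with \<open>a = q ^ i\<close>,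
  \<open>b = q ^ l\<close>, \<open>x = q ^ (i^2)\<close>, \<open>s = (-1) ^ i\<close>, while
  \<open>A\<close> to \<open>E\<close> stand for q-shifted factorials. Dividing by the common factor
  \<open>K\<close> leaves a polynomial identity in \<open>q\<close>, \<open>a\<close>,
  \<open>b\<close>.\<close>

lemma wz_core:
  fixes q a b x s A B C D E :: "'a::field"
  assumes "1 - q * b^2 \<noteq> 0" "1 - q^2 * a^2 \<noteq> 0" "1 - q^2 * a^2 * b^2 \<noteq> 0"
    and "A \<noteq> 0" "B \<noteq> 0" "C \<noteq> 0" "D \<noteq> 0" "E \<noteq> 0"
  shows "(- s) * (x * q * a^2) * (1 - q^5 * a^4 * b^4) * A^2 * C / (B^2 * (D * (1 - q^2 * a^2)) * E^2)
      - s * x * (1 - q^5 * a^4 * b^4) * A^2 * (C * (1 - q^3 * a^2 * b^4)) / (B^2 * D * (E * (1 - q * b^2))^2)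
    = (- s) * (x * q * a^2) * (A * (1 - q^3 * a^2 * b^2))^2 * (C * (1 - q^3 * a^2 * b^4))
        / (B^2 * (D * (1 - q^2 * a^2)) * (E * (1 - q * b^2))^2)
      - s * x * A^2 * C / ((B / (1 - q^2 * a^2 * b^2))^2 * D * (E * (1 - q * b^2))^2)"
proof -
  define u v w where uvw: "u = 1 - q * b^2" "v = 1 - q^2 * a^2" "w = 1 - q^2 * a^2 * b^2"
  have nz: "u \<noteq> 0" "v \<noteq> 0" "w \<noteq> 0" using assms by (simp_all add: uvw)
  define K where "K = s * x * A^2 * C / (B^2 * D * E^2 * v * u^2)"
  have id: "(q * a^2) * (1 - q^5 * a^4 * b^4) * u^2 + (1 - q^5 * a^4 * b^4) * (1 - q^3 * a^2 * b^4) * v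
      = (q * a^2) * (1 - q^3 * a^2 * b^2)^2 * (1 - q^3 * a^2 * b^4) + w^2 * v"
    unfolding uvw by algebra
  have "(- s) * (x * q * a^2) * (1 - q^5 * a^4 * b^4) * A^2 * C / (B^2 * (D * v) * E^2)
      - s * x * (1 - q^5 * a^4 * b^4) * A^2 * (C * (1 - q^3 * a^2 * b^4)) / (B^2 * D * (E * u)^2)
     = - K * ((q * a^2) * (1 - q^5 * a^4 * b^4) * u^2 + (1 - q^5 * a^4 * b^4) * (1 - q^3 * a^2 * b^4) * v)"
    using nz assms(4-) unfolding K_def by (simp add: divide_simps power_mult_distrib) algebra
  also have "\<dots> = - K * ((q * a^2) * (1 - q^3 * a^2 * b^2)^2 * (1 - q^3 * a^2 * b^4) + w^2 * v)"
    unfolding id ..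
  also have "\<dots> = (- s) * (x * q * a^2) * (A * (1 - q^3 * a^2 * b^2))^2 * (C * (1 - q^3 * a^2 * b^4))
        / (B^2 * (D * v) * (E * u)^2)
      - s * x * A^2 * C / ((B / w)^2 * D * (E * u)^2)"
    using nz assms(4-) unfolding K_def by (simp add: divide_simps power_mult_distrib) algebra
  finally show ?thesis unfolding uvw .
qed


lemma wz_step:
  fixes q :: "'a::field"
  assumes nz: "\<And>j. 0 < j \<Longrightarrow> j \<le> 2 * N \<Longrightarrow> q ^ j \<noteq> 1"
    and "k \<le> N" "l < N"
  shows "wz_F q k l - wz_F q k (Suc l) = wz_G q (Suc k) (Suc l) - wz_G q k (Suc l)"
proof -
  have odd_nz: "qpoch q (q^2) i \<noteq> 0" if "i \<le> N" for i
    using that by (intro qpoch_odd_nz nz) auto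
  have even_nz: "qpoch (q^2) (q^2) i \<noteq> 0" if "i \<le> N" for i
    using that by (intro qpoch_even_nz nz) auto
  \<comment> \<open>For \<open>k < l\<close> all four terms are zero by convention; for
    \<open>k = l\<close> so are \<open>F(l,l+1)\<close> and \<open>G(l,l+1)\<close>, and the
    remaining two terms agree directly.\<close>
  consider "k < l" | "k = l" | i where "k = l + 1 + i"
    by (metis add.commute add.left_commute less_imp_Suc_add linorder_neqE_nat plus_1_eq_Suc)
  then show ?thesis
  proof cases
    case 1
    then show ?thesis by (simp add: wz_F_def wz_G_def)
  next
    case 2
    have "wz_F q l l = (1 - q ^ (4*l+1)) * qpoch q (q^2) (2*l) / qpoch (q^2) (q^2) l ^ 2"
      using odd_nz [of l] assms by (simp add: wz_F_def divide_simps mult_2)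
    also have "\<dots> = wz_G q (Suc l) (Suc l)"
      using odd_nz [of "Suc l"] assms qpoch_odd_Suc [of q "2*l"]
      by (simp add: wz_G_def divide_simps mult_2 [symmetric] del: power_Suc)
    finally show ?thesis
      using 2 by (simp add: wz_F_def [of q l "Suc l"] wz_G_def [of q l "Suc l"])
  next
    case 3
    show ?thesis
    \<comment> \<open>Powers of \<open>q\<close> beyond \<open>2 * N\<close> may equal 1, as happens
      when the identity is applied at a root of unity of order \<open>2 * N + 1\<close>. This
      factorial divides all four numerators.\<close>
    proof (cases "qpoch q (q^2) (k + l) = 0")
      case True
      then have "wz_F q k l = 0" "wz_F q k (Suc l) = 0" "wz_G q (Suc k) (Suc l) = 0" "wz_G q k (Suc l) = 0"
        by (simp_all add: wz_F_def wz_G_def qpoch_odd_Suc)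
      then show ?thesis by simp
    next
      case False
      define a b where "a = q ^ i" and "b = q ^ l"
      have pw1: "q ^ (2*l+1) = q^1 * b^2" "q ^ (2*i+2) = q^2 * a^2" "q ^ (2*k) = q^2 * a^2 * b^2"
        "q ^ (4*k+1) = q^5 * a^4 * b^4" "q ^ (2*k+1) = q^3 * a^2 * b^2"
        "q ^ (2*(k+l)+1) = q^3 * a^2 * b^4" "q ^ ((Suc i)^2) = q ^ (i^2) * q^1 * a^2"
        unfolding a_def b_def 3 power_mult [symmetric] power_add [symmetric]
        by (rule arg_cong [of _ _ "power q"]; simp add: power2_eq_square)+
      note pw = pw1 [unfolded power_one_right]
      have nz': "1 - q ^ (2*l+1) \<noteq> 0" "1 - q ^ (2*i+2) \<noteq> 0" "1 - q ^ (2*k) \<noteq> 0"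
        using nz [of "2*l+1"] nz [of "2*i+2"] nz [of "2*k"] assms 3 by auto
      have ek: "qpoch (q^2) (q^2) (k - 1) = qpoch (q^2) (q^2) k / (1 - q ^ (2*k))"
        using nz' qpoch_even_Suc [of q "k - 1"] 3 by (simp add: divide_simps)
      have kl: "k - l = Suc i" "k - Suc l = i" "Suc k - Suc l = Suc i" "Suc k - 1 = k" "k + Suc l - 1 = k + l"
        "Suc k + Suc l - 1 = Suc (k + l)" "k + Suc l = Suc (k + l)"
        and le: "(k < l) = False" "(k < Suc l) = False" "(Suc k < Suc l) = False"
        using 3 by auto
      have sgn: "(-1) ^ Suc i = - ((-1) ^ i :: 'a)" by simp
      show ?thesis
        unfolding wz_F_def wz_G_def kl le if_False diff_Suc_1 qpoch_odd_Suc qpoch_even_Suc pw ek sgn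
        by (rule wz_core)
          (use nz' [unfolded pw] odd_nz even_nz False assms 3 in simp_all)
    qed
  qed
qed

text \<open>Telescoping in \<open>k\<close> leaves only \<open>G(N+1,l+1)\<close>, because
  \<open>G(0,l+1) = 0\<close>. Telescoping in \<open>l\<close> ends with the terms
  \<open>F(k,N)\<close>, which are zero for \<open>k < N\<close>.\<close>

lemma wz_sum:
  fixes q :: "'a::field"
  assumes nz: "\<And>j. 0 < j \<Longrightarrow> j \<le> 2 * N \<Longrightarrow> q ^ j \<noteq> 1"
  shows "(\<Sum>k\<le>N. wz_F q k 0) = wz_F q N N + (\<Sum>l<N. wz_G q (Suc N) (Suc l))"
proof -
  have step: "(\<Sum>k\<le>N. wz_F q k l) - (\<Sum>k\<le>N. wz_F q k (Suc l)) = wz_G q (Suc N) (Suc l)" if "l < N" for l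
  proof -
    have "(\<Sum>k\<le>N. wz_F q k l) - (\<Sum>k\<le>N. wz_F q k (Suc l)) =
        (\<Sum>k\<le>N. wz_G q (Suc k) (Suc l) - wz_G q k (Suc l))"
      unfolding sum_subtractf [symmetric] using assms that by (intro sum.cong refl wz_step [of N]) auto
    also have "\<dots> = wz_G q (Suc N) (Suc l) - wz_G q 0 (Suc l)"
      unfolding lessThan_Suc_atMost [symmetric] by (rule sum_lessThan_telescope)
    finally show ?thesis by (simp add: wz_G_def)
  qed
  have "(\<Sum>k\<le>N. wz_F q k 0) - (\<Sum>k\<le>N. wz_F q k M) = (\<Sum>l<M. wz_G q (Suc N) (Suc l))" if "M \<le> N" for M
    using that by (induction M) (simp_all add: algebra_simps flip: step)
  from this [of N] have "(\<Sum>k\<le>N. wz_F q k 0) = (\<Sum>k\<le>N. wz_F q k N) + (\<Sum>l<N. wz_G q (Suc N) (Suc l))"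
    by (simp add: algebra_simps)
  also have "(\<Sum>k\<le>N. wz_F q k N) = (\<Sum>k\<in>{N}. wz_F q k N)"
    by (rule sum.mono_neutral_right) (auto simp: wz_F_def)
  finally show ?thesis by simp
qed

section \<open>Identities at roots of unity\<close>

lemma qint_eq: "(z::'a::field) \<noteq> 1 \<Longrightarrow> qint z k = (1 - z ^ k) / (1 - z)"
  by (simp add: qint_def sum_gp_strict)

text \<open>The exponents \<open>2 * (m - i)\<close> and \<open>2 * i + 1\<close> add up to the
  period \<open>2 * m + 1\<close>, so each top factor of the even factorial is, up to sign and a
  power of \<open>w\<close>, a bottom factor of the odd one. The powers accumulate to
  \<open>1 + 3 + ... + (2 * i - 1) = i^2\<close>.\<close>

lemma reflect_even:
  fixes w :: "'a::field"
  assumes "w ^ (2*m+1) = 1" "i \<le> m"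
  shows "w ^ (i^2) * qpoch (w^2) (w^2) m = (-1) ^ i * qpoch (w^2) (w^2) (m - i) * qpoch w (w^2) i"
  using assms(2)
proof (induction i)
  case (Suc i)
  have eq1: "2 * (m - Suc i) + 2 + (2*i+1) = 2*m+1"
    using Suc.prems by simp
  have "w ^ (2 * (m - Suc i) + 2) * w ^ (2*i+1) = 1"
    using Suc.prems by (simp only: power_add [symmetric] eq1 assms(1))
  then have *: "w ^ (2*i+1) * (1 - w ^ (2 * (m - Suc i) + 2)) = - (1 - w ^ (2*i+1))"
    by (simp add: algebra_simps)
  have "w ^ ((Suc i)^2) = w ^ (2*i+1) * w ^ (i^2)"
    unfolding power_add [symmetric] by (rule arg_cong [of _ _ "power w"]) (simp add: power2_eq_square)
  then have "w ^ ((Suc i)^2) * qpoch (w^2) (w^2) m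
      = w ^ (2*i+1) * ((-1) ^ i * qpoch (w^2) (w^2) (Suc (m - Suc i)) * qpoch w (w^2) i)"
    using Suc by (simp only: mult.assoc Suc_diff_Suc Suc_le_eq less_imp_le)
  also have "\<dots> = (w ^ (2*i+1) * (1 - w ^ (2 * (m - Suc i) + 2)))
      * ((-1) ^ i * qpoch (w^2) (w^2) (m - Suc i) * qpoch w (w^2) i)"
    unfolding qpoch_even_Suc by (simp only: mult_ac)
  also have "\<dots> = (-1) ^ Suc i * qpoch (w^2) (w^2) (m - Suc i) * qpoch w (w^2) (Suc i)"
    unfolding * qpoch_odd_Suc by (simp add: algebra_simps)
  finally show ?case .
qed simp

text \<open>The same pairing with the parities exchanged; now the powers accumulate to
  \<open>2 + 4 + ... + 2 * i = i * (i + 1)\<close>.\<close>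

lemma reflect_odd:
  fixes w :: "'a::field"
  assumes "w ^ (2*m+1) = 1" "i \<le> m"
  shows "w ^ (i * (i + 1)) * qpoch w (w^2) m = (-1) ^ i * qpoch w (w^2) (m - i) * qpoch (w^2) (w^2) i"
  using assms(2)
proof (induction i)
  case (Suc i)
  have eq1: "2 * (m - Suc i) + 1 + (2*i+2) = 2*m+1"
    using Suc.prems by simp
  have "w ^ (2 * (m - Suc i) + 1) * w ^ (2*i+2) = 1"
    using Suc.prems by (simp only: power_add [symmetric] eq1 assms(1))
  then have *: "w ^ (2*i+2) * (1 - w ^ (2 * (m - Suc i) + 1)) = - (1 - w ^ (2*i+2))"
    by (simp add: algebra_simps)
  have "w ^ (Suc i * (Suc i + 1)) = w ^ (2*i+2) * w ^ (i * (i + 1))"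
    unfolding power_add [symmetric] by (rule arg_cong [of _ _ "power w"]) simp
  then have "w ^ (Suc i * (Suc i + 1)) * qpoch w (w^2) m
      = w ^ (2*i+2) * ((-1) ^ i * qpoch w (w^2) (Suc (m - Suc i)) * qpoch (w^2) (w^2) i)"
    using Suc by (simp only: mult.assoc Suc_diff_Suc Suc_le_eq less_imp_le)
  also have "\<dots> = (w ^ (2*i+2) * (1 - w ^ (2 * (m - Suc i) + 1)))
      * ((-1) ^ i * qpoch w (w^2) (m - Suc i) * qpoch (w^2) (w^2) i)"
    unfolding qpoch_odd_Suc by (simp only: mult_ac)
  also have "\<dots> = (-1) ^ Suc i * qpoch w (w^2) (m - Suc i) * qpoch (w^2) (w^2) (Suc i)"
    unfolding * qpoch_even_Suc by (simp add: algebra_simps)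
  finally show ?case .
qed simp

text \<open>At an \<open>n\<close>-th root of unity \<open>v\<close> other than 1, the function
  \<open>v / (1 - v)^2\<close> is a polynomial in \<open>v\<close> with coefficients
  \<open>i * (n - i) / (2 * n)\<close>. Each nonconstant power sums to -1 over the nontrivial roots,
  which leaves a polynomial sum in \<open>i\<close>.\<close>

lemma sum_roots_unity_rational:
  fixes w :: complex
  assumes w: "w ^ n = 1" and prim: "\<And>j. 0 < j \<Longrightarrow> j < n \<Longrightarrow> w ^ j \<noteq> 1" and "n > 0"
  shows "(\<Sum>j=1..<n. w ^ j / (1 - w ^ j)^2) = - (of_nat n ^ 2 - 1) / 12"
proof -
  have geo: "(\<Sum>i<n. v ^ i) = 0" if "v ^ n = 1" "v \<noteq> 1" for v :: complex
    using that by (simp add: sum_gp_strict)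
  have expand: "v / (1 - v)^2 = (\<Sum>i<n. of_nat i * (of_nat n - of_nat i) * v ^ i) / (2 * of_nat n)"
    if v: "v ^ n = 1" "v \<noteq> 1" for v :: complex
  proof -
    define S1 S2 where "S1 = (\<Sum>i<n. of_nat i * v ^ i)" and "S2 = (\<Sum>i<n. of_nat i ^ 2 * v ^ i)"
    \<comment> \<open>Summation by parts, with a free upper limit for the induction; at
      \<open>M = n\<close> the geometric sum vanishes.\<close>
    have "(v - 1) * (\<Sum>i<M. of_nat i * v ^ i) = of_nat M * v ^ M - v * (\<Sum>i<M. v ^ i)" for M
      by (induction M) (simp_all add: algebra_simps)
    from this [of n] have S1: "(v - 1) * S1 = of_nat n"
      using v geo [of v] by (simp add: S1_def)
    have "(v - 1) * (\<Sum>i<M. of_nat i ^ 2 * v ^ i)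
        = of_nat M ^ 2 * v ^ M - v * (2 * (\<Sum>i<M. of_nat i * v ^ i) + (\<Sum>i<M. v ^ i))" for M
      by (induction M) (simp_all add: algebra_simps power2_eq_square)
    from this [of n] have S2: "(v - 1) * S2 = of_nat n ^ 2 - 2 * v * S1"
      using v geo [of v] by (simp add: S1_def S2_def)
    have "(v - 1)^2 * (of_nat n * S1 - S2) = 2 * of_nat n * v"
    proof -
      have "(v - 1)^2 * (of_nat n * S1 - S2)
          = (v - 1) * (of_nat n * ((v - 1) * S1) - (v - 1) * S2)"
        by (simp add: power2_eq_square algebra_simps)
      also have "\<dots> = 2 * v * ((v - 1) * S1)"
        unfolding S1 S2 by (simp add: power2_eq_square S1)
      finally show ?thesis unfolding S1 by simp
    qed
    moreover have "(\<Sum>i<n. of_nat i * (of_nat n - of_nat i) * v ^ i) = of_nat n * S1 - S2"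
      by (simp add: S1_def S2_def sum_distrib_left sum_subtractf [symmetric] algebra_simps power2_eq_square)
    ultimately show ?thesis
      using v \<open>n > 0\<close> by (simp add: divide_simps power2_commute mult_ac)
  qed
  have inner: "(\<Sum>j=1..<n. (w ^ j) ^ i) = -1" if "0 < i" "i < n" for i
  proof -
    have "(\<Sum>j<n. (w ^ i) ^ j) = 0"
      using prim [OF that] w by (intro geo) (metis mult.commute power_mult power_one)
    moreover have "{..<n} = insert 0 {1..<n}"
      using \<open>n > 0\<close> by auto
    ultimately show ?thesis
      by (simp add: power_mult [symmetric] mult.commute add_eq_0_iff)
  qed
  have "(\<Sum>j=1..<n. w ^ j / (1 - w ^ j)^2)
      = (\<Sum>j=1..<n. (\<Sum>i<n. of_nat i * (of_nat n - of_nat i) * (w ^ j) ^ i) / (2 * of_nat n))"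
  proof (intro sum.cong refl expand)
    fix j assume "j \<in> {1..<n}"
    then show "w ^ j \<noteq> 1" "(w ^ j) ^ n = 1"
      using prim [of j] w by (simp_all add: power_mult [symmetric] mult.commute [of j] power_mult [of w n])
  qed
  also have "\<dots> = (\<Sum>i<n. of_nat i * (of_nat n - of_nat i) * (\<Sum>j=1..<n. (w ^ j) ^ i)) / (2 * of_nat n)"
    by (subst sum_divide_distrib [symmetric], subst sum.swap) (simp add: sum_distrib_left)
  also have "(\<Sum>i<n. of_nat i * (of_nat n - of_nat i) * (\<Sum>j=1..<n. (w ^ j) ^ i))
      = - (\<Sum>i<n. of_nat i * (of_nat n - of_nat i) :: complex)"
    unfolding sum_negf [symmetric]
  proof (intro sum.cong refl)
    fix i assume "i \<in> {..<n}"
    then show "of_nat i * (of_nat n - of_nat i) * (\<Sum>j=1..<n. (w ^ j) ^ i)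
        = - (of_nat i * (of_nat n - of_nat i) :: complex)"
      using inner [of i] by (cases "i = 0") simp_all
  qed
  also have "(\<Sum>i<n. of_nat i * (of_nat n - of_nat i)) = (of_nat n * (of_nat n ^ 2 - 1) / 6 :: complex)"
  proof -
    \<comment> \<open>The constant \<open>c\<close> replaces \<open>n\<close>, so that the induction
      moves only the upper limit.\<close>
    have "(\<Sum>i<M. of_nat i * (c - of_nat i)) =
        of_nat M * (of_nat M - 1) * (3 * c - 2 * of_nat M + 1) / (6 :: complex)" for M c
      by (induction M) (simp_all add: field_simps)
    from this [of "of_nat n" n] show ?thesis
      by (simp add: field_simps power2_eq_square)
  qed
  also have "- (of_nat n * (of_nat n ^ 2 - 1) / 6) / (2 * of_nat n) = (- (of_nat n ^ 2 - 1) / 12 :: complex)"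
    using \<open>n > 0\<close> by (simp add: diff_divide_distrib)
  finally show ?thesis .
qed

text \<open>The summand is invariant under \<open>w ^ j\<close> going to its inverse
  \<open>w ^ (2*m+1-j)\<close>. As the period is odd, this exchanges even and odd exponents, so the
  even ones carry half of the full sum.\<close>

lemma sum_even_roots_unity_rational:
  fixes w :: complex
  assumes w: "w ^ (2*m+1) = 1" and prim: "\<And>j. 0 < j \<Longrightarrow> j < 2*m+1 \<Longrightarrow> w ^ j \<noteq> 1"
  shows "(\<Sum>i<m. w ^ (2*i+2) / (1 - w ^ (2*i+2))^2) = - (of_nat (2*m+1) ^ 2 - 1) / 24"
proof -
  define f where "f j = w ^ j / (1 - w ^ j)^2" for j
  have f_refl: "f (2*m+1-j) = f j" if "j \<le> 2*m+1" for j
  proof -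
    have "w ^ (2*m+1-j) * w ^ j = 1"
      using w that by (simp flip: power_add)
    then have inv: "w ^ (2*m+1-j) = inverse (w ^ j)"
      by (metis inverse_unique mult.commute)
    have "w \<noteq> 0"
      using w by (intro notI) simp
    then show ?thesis
      unfolding f_def inv by (cases "w ^ j = 1") (simp_all add: divide_simps power2_eq_square algebra_simps)
  qed
  have "(\<Sum>i<M. f (2*i+2)) + (\<Sum>i<M. f (2*i+1)) = (\<Sum>j=1..<2*M+1. f j)" for M
    by (induction M) (simp_all add: algebra_simps)
  then have "(\<Sum>i<m. f (2*i+2)) + (\<Sum>i<m. f (2*i+1)) = - (of_nat (2*m+1) ^ 2 - 1) / 12"
    using sum_roots_unity_rational [of w "2*m+1"] assms by (simp add: f_def)
  also have "(\<Sum>i<m. f (2*i+1)) = (\<Sum>i<m. f (2*(m - Suc i)+1))"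
    by (rule sum.nat_diff_reindex [symmetric])
  also have "\<dots> = (\<Sum>i<m. f (2*i+2))"
  proof (intro sum.cong refl)
    fix i assume "i \<in> {..<m}"
    then have "2*(m - Suc i)+1 = 2*m+1-(2*i+2)" "2*i+2 \<le> 2*m+1" by auto
    then show "f (2*(m - Suc i)+1) = f (2*i+2)" using f_refl by metis
  qed
  finally show ?thesis unfolding f_def by (simp add: field_simps)
qed

section \<open>Asymptotics at primitive roots of unity\<close>

lemma tendsto_qpoch [tendsto_intros]:
  fixes f g :: "'a \<Rightarrow> complex"
  assumes "(f \<longlongrightarrow> a) F" "(g \<longlongrightarrow> b) F"
  shows "((\<lambda>z. qpoch (f z) (g z) k) \<longlongrightarrow> qpoch a b k) F"
  unfolding qpoch_def by (intro tendsto_intros assms)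

lemma tendsto_qint [tendsto_intros]:
  fixes f :: "'a \<Rightarrow> complex"
  assumes "(f \<longlongrightarrow> a) F"
  shows "((\<lambda>z. qint (f z) k) \<longlongrightarrow> qint a k) F"
  unfolding qint_def by (intro tendsto_intros assms)

lemma eventually_notin_finite:
  fixes w :: complex
  assumes "finite S"
  shows "\<forall>\<^sub>F z in at w. z \<notin> S"
proof -
  have "open (- (S - {w}))"
    using assms by (intro open_Compl finite_imp_closed) auto
  then show ?thesis
    unfolding eventually_at_topological by (intro exI [of _ "- (S - {w})"]) auto
qed

lemma eventually_power_neq_1:
  fixes w :: complex
  assumes "j > 0"
  shows "\<forall>\<^sub>F z in at w. z ^ j \<noteq> 1"
  using eventually_notin_finite [OF finite_roots_unity [of j]] assms by simp

lemma eventually_powers_neq_1: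
  fixes w :: complex
  shows "\<forall>\<^sub>F z in at w. \<forall>j\<in>{0<..N}. z ^ j \<noteq> 1"
  by (intro eventually_ball_finite ballI eventually_power_neq_1) auto

text \<open>First-order expansion of a product of factors near 1. It is applied with
  \<open>e = (1 - z ^ n)^2\<close>, where it yields the second-order term of the diagonal
  \<open>F(m,m)\<close>.\<close>

lemma tendsto_prod_perturbation:
  fixes y :: "'i \<Rightarrow> 'a \<Rightarrow> complex"
  assumes "finite I" "(e \<longlongrightarrow> 0) F" "\<forall>\<^sub>F z in F. e z \<noteq> 0"
    and "\<And>i. i \<in> I \<Longrightarrow> (y i \<longlongrightarrow> l i) F"
  shows "((\<lambda>z. ((\<Prod>i\<in>I. 1 + e z * y i z) - 1) / e z) \<longlongrightarrow> (\<Sum>i\<in>I. l i)) F"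
  using assms(1,4)
proof (induction I rule: finite_induct)
  case (insert i I)
  define p where "p z = (\<Prod>i\<in>I. 1 + e z * y i z)" for z
  have "((\<lambda>z. (p z - 1) / e z + y i z * p z) \<longlongrightarrow> sum l I + l i * (\<Prod>i\<in>I. 1 + 0 * l i)) F"
    unfolding p_def using insert assms(2) by (intro tendsto_intros) auto
  moreover have "\<forall>\<^sub>F z in F. (p z - 1) / e z + y i z * p z = ((\<Prod>i\<in>insert i I. 1 + e z * y i z) - 1) / e z"
    using assms(3) by eventually_elim (use insert in \<open>simp add: p_def field_simps\<close>)
  ultimately have "((\<lambda>z. ((\<Prod>i\<in>insert i I. 1 + e z * y i z) - 1) / e z) \<longlongrightarrow>
      sum l I + l i * (\<Prod>i\<in>I. 1 + 0 * l i)) F"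
    using tendsto_cong by fast
  then show ?case using insert by (simp add: add.commute)
qed simp

lemma sign_swap: "x = (-1) ^ k * y \<Longrightarrow> y = (-1) ^ k * (x :: 'a::comm_ring_1)"
  by simp

text \<open>Applied with \<open>h = 1 - z ^ n\<close>, \<open>u = 1 - z\<close>,
  \<open>c = z ^ (m * (m + 1))\<close>, \<open>x = z ^ (m^2)\<close>, the sign
  \<open>e = (-1) ^ m\<close>, the product \<open>P\<close> of the diagonal term and
  \<open>K = (n^2 - 1) / 24\<close>.\<close>

lemma wz_main_rearrange:
  fixes h c u :: "'a::field"
  assumes "h \<noteq> 0" "c \<noteq> 0" "u \<noteq> 0"
  shows "e / u * (x * ((P - 1) / h^2) - 1 / c * K)
    = (h * (e * x * P) / u - e * (1 / c) * (x * c * (h / u) + K * h ^ 3 / u)) / h ^ 3"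
proof -
  have "(h * (e * x * P) / u - e * (1 / c) * (x * c * (h / u) + K * h ^ 3 / u))
      = h * (e / u) * (x * (P - 1) - 1 / c * K * h^2)"
    using assms by (simp add: power3_eq_cube power2_eq_square algebra_simps)
  moreover have "x * ((P - 1) / h^2) - 1 / c * K = (x * (P - 1) - 1 / c * K * h^2) / h^2"
    using assms by (simp add: diff_divide_distrib right_diff_distrib)
  ultimately show ?thesis
    using assms by (simp add: power3_eq_cube power2_eq_square)
qed

section \<open>The two sides of the congruence as complex functions\<close>

definition lhs_fun :: "nat \<Rightarrow> complex \<Rightarrow> complex" where
  "lhs_fun N z = (\<Sum>k=0..N. (-1) ^ k * z ^ (k ^ 2) * qint z (4 * k + 1)
        * (qpoch z (z ^ 2) k ^ 3 / qpoch (z ^ 2) (z ^ 2) k ^ 3))"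

definition rhs_main :: "nat \<Rightarrow> complex \<Rightarrow> complex" where
  "rhs_main n z = (-1) ^ ((n - 1) div 2) * z powi ((1 - int n ^ 2) div 4)
        * (z ^ (n choose 2) * qint z n
           + ((of_nat n ^ 2 - 1) * (1 - z) ^ 2 / 24) * qint z n ^ 3)"

definition rhs_tail :: "nat \<Rightarrow> complex \<Rightarrow> complex" where
  "rhs_tail n z = qint z n ^ 3
        * (\<Sum>k=1..(n - 1) div 2. z ^ k * qpoch (z ^ 2) (z ^ 2) k
            / (qint z (2 * k) * qint z (2 * k - 1) * qpoch z (z ^ 2) k))"

lemma lhs_summand_wz:
  fixes z :: complex
  assumes "z \<noteq> 1"
  shows "(-1) ^ k * z ^ (k ^ 2) * qint z (4 * k + 1)
      * (qpoch z (z ^ 2) k ^ 3 / qpoch (z ^ 2) (z ^ 2) k ^ 3) = wz_F z k 0 / (1 - z)"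
  using assms by (simp add: wz_F_def qint_eq power3_eq_cube power2_eq_square mult_ac)

text \<open>Here \<open>n\<close> is the order of \<open>w\<close>. In the final argument it is
  instantiated with a divisor of the index of the modulus, equal to that index only at primitive
  roots.\<close>

locale odd_prim_root =
  fixes m n :: nat and w :: complex
  assumes n_def: "n = 2 * m + 1"
    and m_pos: "m > 0"
    and root: "w ^ n = 1"
    and prim: "\<And>j. 0 < j \<Longrightarrow> j < n \<Longrightarrow> w ^ j \<noteq> 1"
begin

lemma w_nz [simp]: "w \<noteq> 0"
  using root n_def by (intro notI) simp

lemma power_mod: "w ^ (a + n * b) = w ^ a" "w ^ (n * b + a) = w ^ a" "w ^ (n + a) = w ^ a" "w ^ (a + n) = w ^ a"
  by (simp_all add: power_add power_mult root)

lemma odd_nz: "k \<le> m \<Longrightarrow> qpoch w (w^2) k \<noteq> 0"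
  by (rule qpoch_odd_nz, rule prim) (auto simp: n_def)

lemma power_neq_1:
  assumes "\<not> n dvd j"
  shows "w ^ j \<noteq> 1"
proof -
  have "w ^ j = w ^ (j mod n)"
    by (metis mult_div_mod_eq power_mod(2))
  moreover have "0 < j mod n" "j mod n < n"
    using assms by (auto simp: n_def dvd_eq_mod_eq_0)
  ultimately show ?thesis
    using prim by simp
qed

text \<open>As \<open>n\<close> is odd, it divides \<open>2 * (i + 1)\<close> only if it divides
  \<open>i + 1\<close>. The range therefore reaches up to \<open>n - 1\<close>, past the bound
  \<open>m\<close> of \<open>odd_nz\<close>.\<close>

lemma even_nz:
  assumes "k < n"
  shows "qpoch (w^2) (w^2) k \<noteq> 0"
proof -
  have "1 - w ^ (2*i+2) \<noteq> 0" if "i < k" for i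
  proof -
    have "coprime n 2" by (simp add: n_def)
    moreover have "\<not> n dvd Suc i"
      using that assms by (auto dest: dvd_imp_le)
    ultimately have "\<not> n dvd 2 * Suc i"
      by (metis coprime_dvd_mult_right_iff)
    then show ?thesis using power_neq_1 [of "2 * Suc i"] by simp
  qed
  then show ?thesis by (simp add: qpoch_even_prod)
qed

lemma tendsto_h: "((\<lambda>z. 1 - z ^ n) \<longlongrightarrow> 0) (at w)"
proof -
  have "((\<lambda>z. 1 - z ^ n) \<longlongrightarrow> 1 - w ^ n) (at w)"
    by (intro tendsto_intros)
  then show ?thesis by (simp add: root)
qed

lemma eventually_h_nz: "\<forall>\<^sub>F z in at w. 1 - z ^ n \<noteq> 0"
  using eventually_power_neq_1 [of n w] by (simp add: n_def)

text \<open>The factor of index \<open>m\<close> is exactly \<open>1 - z ^ n\<close>. The later odd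
  exponents \<open>n + 2*i + 2\<close> reduce to even ones at \<open>w\<close>, whence the even
  factorial in the limit.\<close>

lemma tendsto_odd:
  "((\<lambda>z. qpoch z (z^2) (Suc m + i) / (1 - z ^ n)) \<longlongrightarrow> qpoch w (w^2) m * qpoch (w^2) (w^2) i) (at w)"
proof (induction i)
  case 0
  have "((\<lambda>z. qpoch z (z^2) m) \<longlongrightarrow> qpoch w (w^2) m) (at w)"
    by (intro tendsto_intros)
  moreover have "\<forall>\<^sub>F z in at w. qpoch z (z^2) m = qpoch z (z^2) (Suc m + 0) / (1 - z ^ n)"
    using eventually_h_nz by eventually_elim (simp add: qpoch_odd_Suc n_def)
  ultimately show ?case using tendsto_cong by fastforce
next
  case (Suc i)
  have "((\<lambda>z. qpoch z (z^2) (Suc m + i) / (1 - z ^ n) * (1 - z ^ (n + (2*i+2))))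
      \<longlongrightarrow> qpoch w (w^2) m * qpoch (w^2) (w^2) i * (1 - w ^ (n + (2*i+2)))) (at w)"
    by (intro tendsto_intros Suc)
  moreover have "qpoch z (z^2) (Suc m + Suc i) / (1 - z ^ n)
      = qpoch z (z^2) (Suc m + i) / (1 - z ^ n) * (1 - z ^ (n + (2*i+2)))" for z :: complex
  proof -
    have "n + (2*i+2) = 2 * (Suc m + i) + 1" by (simp add: n_def)
    then show ?thesis by (simp only: add_Suc_right qpoch_odd_Suc) simp
  qed
  ultimately show ?case
    by (simp only: power_mod qpoch_even_Suc mult.assoc)
qed

text \<open>The odd factorial of length \<open>2 * m + 1\<close> is symmetric around its middle
  factor \<open>1 - z ^ n\<close>: exponents \<open>n - 2*j\<close> and \<open>n + 2*j\<close> are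
  paired and matched with the denominator \<open>(1 - z ^ (2*j))^2\<close>.\<close>

lemma wz_F_diagonal:
  fixes z :: complex
  assumes nz: "\<And>j. 0 < j \<Longrightarrow> j \<le> n \<Longrightarrow> z ^ j \<noteq> 1" and "z \<noteq> 0"
  shows "wz_F z m m = (1 - z ^ n) * ((-1) ^ m * z ^ (m^2)
      * (\<Prod>i<m. 1 + (1 - z ^ n)^2 * (- (z ^ (2*i+2)) / (z ^ n * (1 - z ^ (2*i+2))^2))))"
proof -
  have nz': "1 - z ^ (2*i+2) \<noteq> 0" if "i < m" for i
    using nz [of "2*i+2"] that by (simp add: n_def)
  have onz: "qpoch z (z^2) m \<noteq> 0" and enz: "qpoch (z^2) (z^2) m \<noteq> 0"
    by (intro qpoch_odd_nz qpoch_even_nz nz; simp add: n_def)+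
  \<comment> \<open>The factor \<open>1 - z ^ (4*m+1)\<close> extends the factorial of length
    \<open>2 * m\<close> by one.\<close>
  have "wz_F z m m = qpoch z (z^2) (Suc (2*m)) / qpoch (z^2) (z^2) m ^ 2"
    using onz by (simp add: wz_F_def qpoch_odd_Suc mult_2 [symmetric] divide_simps)
  also have "qpoch z (z^2) (Suc (2*m)) = (\<Prod>i<m. 1 - z ^ (2*i+1)) * (1 - z ^ n) * (\<Prod>i<m. 1 - z ^ (n + (2*i+2)))"
  proof -
    have "qpoch z (z^2) (Suc m + M) = (\<Prod>i<m. 1 - z ^ (2*i+1)) * (1 - z ^ n) * (\<Prod>i<M. 1 - z ^ (n + (2*i+2)))" for M
    proof (induction M)
      case (Suc M)
      have "n + (2*M+2) = 2 * (Suc m + M) + 1" by (simp add: n_def)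
      then show ?case unfolding add_Suc_right qpoch_odd_Suc Suc prod.lessThan_Suc by simp
    qed (simp add: qpoch_odd_Suc qpoch_odd_prod n_def)
    from this [of m] show ?thesis by (simp add: mult_2)
  qed
  \<comment> \<open>Reversal turns the \<open>i\<close>-th exponent into \<open>n - (2*i+2)\<close>,
    the partner of \<open>n + (2*i+2)\<close>.\<close>
  also have "(\<Prod>i<m. 1 - z ^ (2*i+1)) = (\<Prod>i<m. 1 - z ^ (2*(m - Suc i)+1))"
    by (rule prod.nat_diff_reindex [symmetric])
  also have "\<dots> * (1 - z ^ n) * (\<Prod>i<m. 1 - z ^ (n + (2*i+2))) / qpoch (z^2) (z^2) m ^ 2
      = (1 - z ^ n) * (\<Prod>i<m. (1 - z ^ (2*(m - Suc i)+1)) * (1 - z ^ (n + (2*i+2))) / (1 - z ^ (2*i+2))^2)"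
    by (simp add: qpoch_even_prod prod.distrib prod_dividef prod_power_distrib)
  also have "(\<Prod>i<m. (1 - z ^ (2*(m - Suc i)+1)) * (1 - z ^ (n + (2*i+2))) / (1 - z ^ (2*i+2))^2)
      = (\<Prod>i<m. - (z ^ (2*(m - Suc i)+1)) * (1 + (1 - z ^ n)^2 * (- (z ^ (2*i+2)) / (z ^ n * (1 - z ^ (2*i+2))^2))))"
  proof (intro prod.cong refl)
    fix i assume "i \<in> {..<m}"
    then have i: "i < m" by simp
    define x y where "x = z ^ (2*i+2)" and "y = z ^ (2*(m - Suc i)+1)"
    have xy: "z ^ n = x * y"
    proof -
      have "n = (2*i+2) + (2*(m - Suc i)+1)" using i by (simp add: n_def)
      then show ?thesis unfolding x_def y_def by (metis power_add)
    qed
    have "x \<noteq> 0" "y \<noteq> 0" "1 - x \<noteq> 0"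
      using \<open>z \<noteq> 0\<close> nz' [OF i] by (simp_all add: x_def y_def)
    \<comment> \<open>This is the identity
      \<open>(1 - y) * (1 - x^2 * y) = (1 - x * y)^2 - y * (1 - x)^2\<close>, where
      \<open>x * y = z ^ n\<close>.\<close>
    then have "(1 - y) * (1 - x * y * x) / (1 - x)^2 = - y * (1 + (1 - x * y)^2 * (- x / (x * y * (1 - x)^2)))"
      by (simp add: divide_simps) algebra
    then show "(1 - y) * (1 - z ^ (n + (2*i+2))) / (1 - x)^2
        = - y * (1 + (1 - z ^ n)^2 * (- x / (z ^ n * (1 - x)^2)))"
      unfolding power_add [of z n] xy x_def [symmetric] by simp
  qed
  also have "\<dots> = (\<Prod>i<m. - (z ^ (2*(m - Suc i)+1)))
      * (\<Prod>i<m. 1 + (1 - z ^ n)^2 * (- (z ^ (2*i+2)) / (z ^ n * (1 - z ^ (2*i+2))^2)))"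
    by (rule prod.distrib)
  also have "(\<Prod>i<m. - (z ^ (2*(m - Suc i)+1))) = (\<Prod>i<m. - (z ^ (2*i+1)))"
    by (rule prod.nat_diff_reindex)
  also have "\<dots> = (-1) ^ m * z ^ (m^2)"
  proof -
    have "(\<Prod>i<M. - (z ^ (2*i+1))) = (-1) ^ M * z ^ (M^2)" for M
      by (induction M) (simp_all add: power2_eq_square power_add algebra_simps mult_2_right)
    then show ?thesis .
  qed
  finally show ?thesis .
qed

lemma w_neq_1 [simp]: "w \<noteq> 1"
  using prim [of 1] m_pos n_def by simp

lemma eventually_generic: "\<forall>\<^sub>F z in at w. z \<noteq> 0 \<and> z \<noteq> 1 \<and> (\<forall>j. 0 < j \<longrightarrow> j \<le> N \<longrightarrow> z ^ j \<noteq> 1)"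
proof -
  have "\<forall>\<^sub>F z in at w. z \<notin> {0, 1}"
    by (rule eventually_notin_finite) simp
  then show ?thesis
    using eventually_powers_neq_1 [where N = N] by eventually_elim auto
qed

lemma sum_perturbation: "(\<Sum>i<m. - (w ^ (2*i+2)) / (w ^ n * (1 - w ^ (2*i+2))^2)) = (of_nat n ^ 2 - 1) / 24"
proof -
  have "(\<Sum>i<m. w ^ (2*i+2) / (1 - w ^ (2*i+2))^2) = - (of_nat n ^ 2 - 1) / 24"
    using sum_even_roots_unity_rational [of w m] root prim by (simp add: n_def)
  then show ?thesis
    by (simp add: root sum_negf)
qed

lemma even_factor_nz: "i < m \<Longrightarrow> 1 - w ^ (2*i+2) \<noteq> 0"
  using prim [of "2*i+2"] by (simp add: n_def)

lemma odd_factor_nz: "i < m \<Longrightarrow> 1 - w ^ (2*i+1) \<noteq> 0"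
  using prim [of "2*i+1"] by (simp add: n_def)

lemma exponents:
  shows "(1 - int n ^ 2) div 4 = - int (m * (m + 1))"
    and "n choose 2 = n * m" "n * m = m^2 + m * (m + 1)"
proof -
  have "1 - int n ^ 2 = (- int (m * (m + 1))) * 4"
    by (simp add: n_def power2_eq_square algebra_simps)
  then show "(1 - int n ^ 2) div 4 = - int (m * (m + 1))"
    by (metis nonzero_mult_div_cancel_right zero_neq_numeral)
  show "n choose 2 = n * m"
    by (simp add: choose_two n_def)
  show "n * m = m^2 + m * (m + 1)"
    by (simp add: n_def power2_eq_square algebra_simps)
qed

text \<open>With \<open>P = 1 + K * (1 - z ^ n)^2 + ...\<close>, the constant 1 cancels exactly
  against the binomial power in \<open>rhs_main\<close>. The terms with \<open>K\<close> have
  coefficients \<open>z ^ (m^2)\<close> and \<open>1 / z ^ (m * (m + 1))\<close>, which agree at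
  \<open>w\<close> because \<open>m^2 + m * (m + 1) = n * m\<close>.\<close>

lemma tendsto_main:
  "((\<lambda>z. (wz_F z m m / (1 - z) - rhs_main n z) / (1 - z ^ n) ^ 3) \<longlongrightarrow> 0) (at w)"
proof -
  define P where "P z = (\<Prod>i<m. 1 + (1 - z ^ n)^2 * (- (z ^ (2*i+2)) / (z ^ n * (1 - z ^ (2*i+2))^2)))" for z :: complex
  define K :: complex where "K = (of_nat n ^ 2 - 1) / 24"
  have "((\<lambda>z. (P z - 1) / (1 - z ^ n)^2) \<longlongrightarrow>
      (\<Sum>i<m. - (w ^ (2*i+2)) / (w ^ n * (1 - w ^ (2*i+2))^2))) (at w)"
    unfolding P_def
  proof (rule tendsto_prod_perturbation)
    show "((\<lambda>z. (1 - z ^ n)^2) \<longlongrightarrow> 0) (at w)"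
      using tendsto_power [OF tendsto_h, of 2] by simp
    show "\<forall>\<^sub>F z in at w. (1 - z ^ n)^2 \<noteq> 0"
      using eventually_h_nz by simp
    show "((\<lambda>z. - (z ^ (2*i+2)) / (z ^ n * (1 - z ^ (2*i+2))^2)) \<longlongrightarrow>
        - (w ^ (2*i+2)) / (w ^ n * (1 - w ^ (2*i+2))^2)) (at w)" if "i \<in> {..<m}" for i
      by (intro tendsto_intros) (use even_factor_nz [of i] that in simp)
  qed simp
  then have lim: "((\<lambda>z. (P z - 1) / (1 - z ^ n)^2) \<longlongrightarrow> K) (at w)"
    by (simp only: sum_perturbation K_def)
  have pw: "w ^ (m^2) = 1 / w ^ (m * (m + 1))"
  proof -
    have "w ^ (m^2) * w ^ (m * (m + 1)) = 1"
      using power_mod(1) [of 0 m] by (simp only: power_add [symmetric] exponents(3) [symmetric]) simp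
    then show ?thesis by (simp add: divide_simps)
  qed
  have "((\<lambda>z. (-1) ^ m / (1 - z) * (z ^ (m^2) * ((P z - 1) / (1 - z ^ n)^2) - 1 / z ^ (m * (m + 1)) * K)) \<longlongrightarrow>
      (-1) ^ m / (1 - w) * (w ^ (m^2) * K - 1 / w ^ (m * (m + 1)) * K)) (at w)"
    by (intro tendsto_intros lim) auto
  then have "((\<lambda>z. (-1) ^ m / (1 - z) * (z ^ (m^2) * ((P z - 1) / (1 - z ^ n)^2) - 1 / z ^ (m * (m + 1)) * K)) \<longlongrightarrow> 0) (at w)"
    by (simp add: pw)
  moreover have "\<forall>\<^sub>F z in at w. (-1) ^ m / (1 - z) * (z ^ (m^2) * ((P z - 1) / (1 - z ^ n)^2) - 1 / z ^ (m * (m + 1)) * K)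
      = (wz_F z m m / (1 - z) - rhs_main n z) / (1 - z ^ n) ^ 3"
    using eventually_generic [of n]
  proof eventually_elim
    case (elim z)
    define h c where "h = 1 - z ^ n" and "c = z ^ (m * (m + 1))"
    have nz: "h \<noteq> 0" "c \<noteq> 0" "1 - z \<noteq> 0"
      using elim n_def by (auto simp: h_def c_def)
    have F: "wz_F z m m = h * ((-1) ^ m * z ^ (m^2) * P z)"
      unfolding h_def P_def by (rule wz_F_diagonal) (use elim in auto)
    have "rhs_main n z = (-1) ^ m * (1 / c) * (z ^ (m^2) * c * (h / (1 - z)) + (of_nat n ^ 2 - 1) * (1 - z) ^ 2 / 24 * (h / (1 - z)) ^ 3)"
    proof -
      have "qint z n = h / (1 - z)"
        unfolding h_def by (rule qint_eq) (use elim in simp)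
      moreover have "z powi ((1 - int n ^ 2) div 4) = 1 / c"
        unfolding exponents(1) c_def power_int_minus power_int_of_nat by (simp only: inverse_eq_divide)
      moreover have "z ^ (n choose 2) = z ^ (m^2) * c"
        by (simp only: exponents(2,3) c_def power_add)
      moreover have "(n - 1) div 2 = m"
        by (simp add: n_def)
      ultimately show ?thesis
        unfolding rhs_main_def by (simp only:)
    qed
    also have "(of_nat n ^ 2 - 1) * (1 - z) ^ 2 / 24 * (h / (1 - z)) ^ 3 = K * h ^ 3 / (1 - z)"
      using nz by (simp add: K_def power3_eq_cube power2_eq_square)
    finally have R: "rhs_main n z = (-1) ^ m * (1 / c) * (z ^ (m^2) * c * (h / (1 - z)) + K * h ^ 3 / (1 - z))" .
    show ?case
      unfolding F R h_def [symmetric] c_def [symmetric]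
      by (rule wz_main_rearrange) (fact nz)+
  qed
  ultimately show ?thesis
    using tendsto_cong by fast
qed

text \<open>The three odd factorials in the numerator each contain \<open>1 - z ^ n\<close> once.
  The limit then involves factorials of index \<open>m\<close> and \<open>m - l\<close>, which the
  reflection formulas remove.\<close>

lemma tendsto_wz_G:
  assumes "l < m"
  shows "((\<lambda>z. wz_G z (Suc m) (Suc l) / (1 - z ^ n) ^ 3) \<longlongrightarrow>
    w ^ Suc l * qpoch (w^2) (w^2) (Suc l) / ((1 - w ^ (2 * Suc l)) * (1 - w ^ (2 * Suc l - 1)) * qpoch w (w^2) (Suc l))) (at w)"
proof -
  have "((\<lambda>z. (-1) ^ (m - l) * z ^ ((m - l)^2) * (qpoch z (z^2) (Suc m + 0) / (1 - z ^ n)) ^ 2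
        * (qpoch z (z^2) (Suc m + l) / (1 - z ^ n))
      / (qpoch (z^2) (z^2) m ^ 2 * qpoch (z^2) (z^2) (m - l) * qpoch z (z^2) (Suc l) ^ 2)) \<longlongrightarrow>
      (-1) ^ (m - l) * w ^ ((m - l)^2) * (qpoch w (w^2) m * qpoch (w^2) (w^2) 0) ^ 2
        * (qpoch w (w^2) m * qpoch (w^2) (w^2) l)
      / (qpoch (w^2) (w^2) m ^ 2 * qpoch (w^2) (w^2) (m - l) * qpoch w (w^2) (Suc l) ^ 2)) (at w)"
    (is "(?f \<longlongrightarrow> ?L) _")
    by (intro tendsto_intros tendsto_odd) (use odd_nz even_nz assms n_def in simp)
  moreover have "?f = (\<lambda>z. wz_G z (Suc m) (Suc l) / (1 - z ^ n) ^ 3)"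
    using assms by (simp add: fun_eq_iff wz_G_def power3_eq_cube power2_eq_square mult_ac)
  moreover have "?L = w ^ Suc l * qpoch (w^2) (w^2) (Suc l) / ((1 - w ^ (2 * Suc l)) * (1 - w ^ (2 * Suc l - 1)) * qpoch w (w^2) (Suc l))"
  proof -
    define A B C D E where "A = qpoch w (w^2) m" "B = qpoch (w^2) (w^2) m" "C = qpoch (w^2) (w^2) l"
      "D = qpoch (w^2) (w^2) (m - l)" "E = qpoch w (w^2) l"
    have nz: "A \<noteq> 0" "B \<noteq> 0" "C \<noteq> 0" "D \<noteq> 0" "E \<noteq> 0"
      using odd_nz even_nz assms n_def by (simp_all add: A_B_C_D_E_def)
    have A: "A = (-1) ^ m * w ^ (m^2) * B"
      using sign_swap [OF reflect_even [of w m m, unfolded mult.assoc]] root n_def by (simp add: A_B_C_D_E_def)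
    have D: "D * E = (-1) ^ l * w ^ (l^2) * B"
      using sign_swap [OF reflect_even [of w m l, unfolded mult.assoc]] root n_def assms by (simp add: A_B_C_D_E_def)
    \<comment> \<open>The exponent \<open>3 * m^2\<close> comes from the cube of \<open>A\<close>;
      modulo \<open>n\<close> the total reduces to \<open>l^2 + l + 1\<close>.\<close>
    have pw: "w ^ ((m - l)^2) * w ^ (3 * m^2) = w ^ (l^2) * w ^ Suc l"
    proof -
      obtain d where d: "m = Suc (l + d)"
        using assms less_imp_Suc_add by blast
      have "(m - l)^2 + 3 * m^2 = (l^2 + Suc l) + n * (m + d)"
        unfolding n_def d by (simp add: power2_eq_square algebra_simps)
      then show ?thesis
        using power_mod(1) [of "l^2 + Suc l" "m + d"] by (metis power_add)
    qed
    have sgn: "(-1) ^ (m - l) * (-1) ^ m = ((-1) ^ l :: complex)"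
      using assms by (simp flip: power_add add: minus_one_power_iff)
    have cancel: "s * x * (A * 1)^2 * (A * C) / (B^2 * D * (E * v)^2) * (D * E) * B^2 * v^2 = s * x * A ^ 3 * C / E"
      if "v \<noteq> 0" for s x v :: complex
      using nz that by (simp add: power3_eq_cube power2_eq_square)
    \<comment> \<open>Multiplication by \<open>D * E\<close> produces the very product that the
      reflection formula evaluates.\<close>
    have "?L * (D * E) * B ^ 2 * (1 - w ^ (2*l+1)) ^ 2 = (-1) ^ (m - l) * w ^ ((m - l)^2) * A ^ 3 * C / E"
      unfolding qpoch_odd_Suc A_B_C_D_E_def [symmetric] qpoch_0
      by (rule cancel) (rule odd_factor_nz [OF assms])
    also have "\<dots> = ((-1) ^ (m - l) * (-1) ^ m) * (w ^ ((m - l)^2) * w ^ (3 * m^2)) * B ^ 3 * C / E"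
      unfolding A by (simp add: power_mult_distrib power_mult [symmetric] mult_ac) (simp add: power_mult, simp add: power3_eq_cube)
    also have "\<dots> = w ^ Suc l * C / E * (D * E) * B ^ 2"
      unfolding sgn pw D by (simp add: power3_eq_cube power2_eq_square)
    finally have "?L * (D * E) * B ^ 2 * (1 - w ^ (2*l+1)) ^ 2 = w ^ Suc l * C / E * (D * E) * B ^ 2" .
    moreover have "x = y * C / (E * v)" if "x * (D * E) * B ^ 2 * v = y * C / E * (D * E) * B ^ 2" "v \<noteq> 0" for x v y
      using that nz by (simp add: divide_simps)
    ultimately have "?L = w ^ Suc l * C / (E * (1 - w ^ (2*l+1)) ^ 2)"
      using odd_factor_nz [OF assms] by (metis power_not_zero)
    also have "w ^ Suc l * C / (E * (1 - w ^ (2*l+1)) ^ 2)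
        = w ^ Suc l * (C * (1 - w ^ (2*l+2))) / ((1 - w ^ (2*l+2)) * (1 - w ^ (2*l+1)) * (E * (1 - w ^ (2*l+1))))"
      using even_factor_nz [OF assms] by (simp add: power2_eq_square mult_ac del: power_Suc add_2_eq_Suc')
    also have "\<dots> = w ^ Suc l * qpoch (w^2) (w^2) (Suc l) / ((1 - w ^ (2 * Suc l)) * (1 - w ^ (2 * Suc l - 1)) * qpoch w (w^2) (Suc l))"
      by (simp add: A_B_C_D_E_def qpoch_odd_Suc qpoch_even_Suc)
    finally show ?thesis .
  qed
  ultimately show ?thesis by simp
qed

section \<open>The terms with \<open>m < k < n\<close>\<close>

lemma even_shift: "qpoch (w^2) (w^2) (m + k) = qpoch (w^2) (w^2) m * qpoch w (w^2) k"
proof (induction k)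
  case (Suc k)
  \<comment> \<open>Past index \<open>m\<close> the even exponents exceed \<open>n\<close>, so
    modulo the period they become odd.\<close>
  have "2 * (m + k) + 2 = n + (2*k+1)" by (simp add: n_def)
  then have "w ^ (2 * (m + k) + 2) = w ^ (2*k+1)"
    by (simp only: power_mod)
  then show ?case
    by (simp only: add_Suc_right qpoch_even_Suc qpoch_odd_Suc Suc mult.assoc)
qed simp

definition upper_lim :: "nat \<Rightarrow> complex" where
  "upper_lim i = (-1) ^ (Suc m + i) * w ^ ((Suc m + i)^2) * (1 - w ^ (4*i+3))
     * (qpoch w (w^2) m * qpoch (w^2) (w^2) i / (qpoch (w^2) (w^2) m * qpoch w (w^2) (Suc i))) ^ 3"

lemma tendsto_upper:
  assumes "i < m"
  shows "((\<lambda>z. wz_F z (Suc m + i) 0 / (1 - z ^ n) ^ 3) \<longlongrightarrow> upper_lim i) (at w)"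
proof -
  have "((\<lambda>z. (-1) ^ (Suc m + i) * z ^ ((Suc m + i)^2) * (1 - z ^ (4 * (Suc m + i) + 1))
        * ((qpoch z (z^2) (Suc m + i) / (1 - z ^ n)) / qpoch (z^2) (z^2) (m + Suc i)) ^ 3) \<longlongrightarrow>
      (-1) ^ (Suc m + i) * w ^ ((Suc m + i)^2) * (1 - w ^ (4 * (Suc m + i) + 1))
        * ((qpoch w (w^2) m * qpoch (w^2) (w^2) i) / qpoch (w^2) (w^2) (m + Suc i)) ^ 3) (at w)"
    (is "(?f \<longlongrightarrow> ?L) _")
    by (intro tendsto_intros tendsto_odd even_nz) (use assms n_def in simp)
  moreover have "?f = (\<lambda>z. wz_F z (Suc m + i) 0 / (1 - z ^ n) ^ 3)"
    by (simp add: fun_eq_iff wz_F_def power3_eq_cube power2_eq_square mult_ac)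
  moreover have "w ^ (4 * (Suc m + i) + 1) = w ^ (4*i+3)"
  proof -
    have "4 * (Suc m + i) + 1 = (4*i+3) + n * 2" by (simp add: n_def)
    then show ?thesis by (simp only: power_mod)
  qed
  ultimately show ?thesis
    unfolding upper_lim_def by (simp only: even_shift)
qed

text \<open>Only odd powers of the reflected quotient occur, so the reflection \<open>i \<mapsto> m - 1 - i\<close> changes the sign.\<close>

lemma upper_lim_reflect:
  assumes "i < m"
  shows "upper_lim (m - Suc i) = - upper_lim i"
proof -
  define A B C D where "A = qpoch w (w^2) m" "B = qpoch (w^2) (w^2) m"
    "C = qpoch (w^2) (w^2) i" "D = qpoch w (w^2) (Suc i)"
  define C' D' where "C' = qpoch (w^2) (w^2) (m - Suc i)" "D' = qpoch w (w^2) (m - i)"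
  have nz: "A \<noteq> 0" "B \<noteq> 0" "C \<noteq> 0" "D \<noteq> 0" "C' \<noteq> 0" "D' \<noteq> 0"
    using odd_nz even_nz assms n_def by (simp_all add: A_B_C_D_def C'_D'_def)
  have A: "A = (-1) ^ m * (w ^ (m^2) * B)"
    using sign_swap [OF reflect_even [of w m m, unfolded mult.assoc]] root n_def by (simp add: A_B_C_D_def)
  have C': "C' * D = (-1) ^ Suc i * (w ^ ((Suc i)^2) * B)"
    using sign_swap [OF reflect_even [of w m "Suc i", unfolded mult.assoc]] root n_def assms
    by (simp only: A_B_C_D_def C'_D'_def Suc_eq_plus1 Suc_le_eq)
  have D': "D' * C = (-1) ^ i * (w ^ (i * (i + 1)) * A)"
    using sign_swap [OF reflect_odd [of w m i, unfolded mult.assoc]] root n_def assms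
    by (simp only: A_B_C_D_def C'_D'_def less_imp_le)
  \<comment> \<open>Both reflections combined: the exponents \<open>(i + 1)^2\<close> and
    \<open>i * (i + 1)\<close> differ by \<open>i + 1\<close>, and the two signs are
    opposite.\<close>
  have qpoch_quot: "A * C' / (B * D') = - (w ^ Suc i) * (C / D)"
  proof -
    have "(Suc i)^2 = i * (i + 1) + Suc i" by (simp add: power2_eq_square)
    then have pw: "w ^ ((Suc i)^2) = w ^ (i * (i + 1)) * w ^ Suc i" by (simp only: power_add)
    have "A * (C' * D) = - (w ^ Suc i) * B * (D' * C)"
      unfolding C' D' pw by (simp only: power_Suc) (simp add: mult_ac)
    then show ?thesis using nz by (simp add: divide_simps mult_ac)
  qed
  have e: "Suc (m - Suc i) = m - i" "Suc m + (m - Suc i) = 2 * m - i"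
    using assms by auto
  have sgn: "(-1) ^ (2 * m - i) = ((-1) ^ i :: complex)"
    using assms by (simp add: minus_one_power_iff)
  have p1: "w ^ ((2 * m - i)^2) = w ^ ((Suc i)^2)"
  proof -
    obtain d where d: "m = Suc (i + d)"
      using assms less_imp_Suc_add by blast
    have "(2 * m - i)^2 = (Suc i)^2 + n * (2 * m - 1 - 2 * i)"
      unfolding n_def d by (simp add: power2_eq_square algebra_simps)
    then show ?thesis by (simp only: power_mod)
  qed
  have p2: "w ^ (4 * (m - Suc i) + 3) * w ^ (4*i+3) = 1"
  proof -
    have "4 * (m - Suc i) + 3 + (4*i+3) = 0 + n * 2" using assms by (simp add: n_def)
    then show ?thesis by (simp only: power_add [symmetric] power_mod power_0)
  qed
  have p3: "w ^ ((Suc m + i)^2) * w ^ (3 * m^2) = w ^ ((Suc i)^2 + 3 * Suc i) / w ^ (4*i+3)"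
  proof -
    have "(Suc m + i)^2 + 3 * m^2 + (4*i+3) = ((Suc i)^2 + 3 * Suc i) + n * (2 * m + i)"
      by (simp add: n_def power2_eq_square algebra_simps)
    then have "w ^ ((Suc m + i)^2 + 3 * m^2 + (4*i+3)) = w ^ ((Suc i)^2 + 3 * Suc i)"
      by (simp only: power_mod)
    then show ?thesis by (simp add: power_add eq_divide_eq mult.assoc)
  qed
  define v where "v = w ^ (4*i+3)"
  have "v \<noteq> 0" by (simp add: v_def)
  have v': "w ^ (4 * (m - Suc i) + 3) = 1 / v"
    using p2 \<open>v \<noteq> 0\<close> by (simp add: v_def eq_divide_eq)
  have "upper_lim (m - Suc i) = (-1) ^ i * w ^ ((Suc i)^2) * (1 - 1 / v) * (- (w ^ Suc i) * (C / D)) ^ 3"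
    unfolding upper_lim_def e sgn p1 v' qpoch_quot [symmetric] unfolding A_B_C_D_def C'_D'_def ..
  also have "\<dots> = (-1) ^ i * (w ^ ((Suc i)^2 + 3 * Suc i) / v) * (1 - v) * (C / D) ^ 3"
  proof -
    have "s * x * (1 - 1 / v) * (- W * r) ^ 3 = s * (x * W ^ 3 / v) * (1 - v) * r ^ 3" for s x W r
      using \<open>v \<noteq> 0\<close> by (simp add: power3_eq_cube field_simps)
    moreover have "w ^ ((Suc i)^2 + 3 * Suc i) = w ^ ((Suc i)^2) * (w ^ Suc i) ^ 3"
      by (simp only: power_add power_mult [symmetric] mult.commute [of 3])
    ultimately show ?thesis by (simp only:)
  qed
  \<comment> \<open>The cube of \<open>(-1) ^ m * w ^ (m^2)\<close> is \<open>(A / B) ^ 3\<close>;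
    it is split off so that the formula for \<open>upper_lim i\<close> reappears.\<close>
  also have "\<dots> = - ((-1) ^ (Suc m + i) * w ^ ((Suc m + i)^2) * (1 - v) * (((-1) ^ m * w ^ (m^2)) ^ 3 * (C / D) ^ 3))"
  proof -
    have "((-1) ^ m * w ^ (m^2)) ^ 3 = (-1) ^ m * w ^ (3 * m^2)"
    proof -
      have "((-1) ^ m) ^ 3 = ((-1) ^ m :: complex)"
        by (simp add: power3_eq_cube)
      then show ?thesis
        by (simp only: power_mult_distrib power_mult [symmetric] mult.commute [of 3])
    qed
    moreover have "(-1) ^ (Suc m + i) * (-1) ^ m = - ((-1) ^ i :: complex)"
      by (simp add: power_add)
    ultimately show ?thesis
      unfolding v_def p3 [symmetric] by (simp add: mult_ac)
  qed
  also have "((-1) ^ m * w ^ (m^2)) ^ 3 * (C / D) ^ 3 = (A * C / (B * D)) ^ 3"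
    unfolding A using nz by (simp add: power_mult_distrib power_divide)
  finally show ?thesis
    unfolding upper_lim_def A_B_C_D_def v_def .
qed

lemma sum_upper_lim: "(\<Sum>i<m. upper_lim i) = 0"
proof -
  have "(\<Sum>i<m. upper_lim i) = (\<Sum>i<m. upper_lim (m - Suc i))"
    by (rule sum.nat_diff_reindex [symmetric])
  also have "\<dots> = - (\<Sum>i<m. upper_lim i)"
    unfolding sum_negf [symmetric] by (intro sum.cong refl upper_lim_reflect) simp
  finally show ?thesis by simp
qed

section \<open>The congruence at primitive roots\<close>

lemma lhs_fun_lower:
  fixes z :: complex
  assumes "z \<noteq> 1" "\<And>j. 0 < j \<Longrightarrow> j < n \<Longrightarrow> z ^ j \<noteq> 1"
  shows "lhs_fun m z = (wz_F z m m + (\<Sum>l<m. wz_G z (Suc m) (Suc l))) / (1 - z)"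
proof -
  have "lhs_fun m z = (\<Sum>k\<le>m. wz_F z k 0) / (1 - z)"
    unfolding lhs_fun_def lhs_summand_wz [OF assms(1)] sum_divide_distrib atLeast0AtMost ..
  then show ?thesis
    using wz_sum [of m z] assms by (simp add: n_def)
qed

lemma tendsto_lower:
  "((\<lambda>z. (lhs_fun m z - (rhs_main n z + rhs_tail n z)) / (1 - z ^ n) ^ 3) \<longlongrightarrow> 0) (at w)"
proof -
  \<comment> \<open>The summand of the tail with each q-integer \<open>[j]\<close> in its
    denominator replaced by \<open>1 - z ^ j\<close>. Against the cube in front, this leaves a
    single \<open>1 - z\<close> below.\<close>
  define T where "T z l = z ^ Suc l * qpoch (z^2) (z^2) (Suc l)
    / ((1 - z ^ (2 * Suc l)) * (1 - z ^ (2 * Suc l - 1)) * qpoch z (z^2) (Suc l))" for z :: complex and l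
  have T: "((\<lambda>z. T z l) \<longlongrightarrow> T w l) (at w)" if "l < m" for l
    unfolding T_def using that even_factor_nz [of l] odd_factor_nz [of l] odd_nz [of "Suc l"]
    by (intro tendsto_intros) simp_all
  have "((\<lambda>z. (wz_F z m m / (1 - z) - rhs_main n z) / (1 - z ^ n) ^ 3
      + (\<Sum>l<m. wz_G z (Suc m) (Suc l) / (1 - z ^ n) ^ 3 - T z l) / (1 - z)) \<longlongrightarrow>
      0 + (\<Sum>l<m. T w l - T w l) / (1 - w)) (at w)"
  proof (intro tendsto_intros tendsto_main T)
    show "((\<lambda>z. wz_G z (Suc m) (Suc l) / (1 - z ^ n) ^ 3) \<longlongrightarrow> T w l) (at w)" if "l \<in> {..<m}" for l
      unfolding T_def using that by (intro tendsto_wz_G) simp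
  qed auto
  then have "((\<lambda>z. (wz_F z m m / (1 - z) - rhs_main n z) / (1 - z ^ n) ^ 3
      + (\<Sum>l<m. wz_G z (Suc m) (Suc l) / (1 - z ^ n) ^ 3 - T z l) / (1 - z)) \<longlongrightarrow> 0) (at w)"
    by simp
  moreover have "\<forall>\<^sub>F z in at w. (wz_F z m m / (1 - z) - rhs_main n z) / (1 - z ^ n) ^ 3
      + (\<Sum>l<m. wz_G z (Suc m) (Suc l) / (1 - z ^ n) ^ 3 - T z l) / (1 - z)
      = (lhs_fun m z - (rhs_main n z + rhs_tail n z)) / (1 - z ^ n) ^ 3"
    using eventually_generic [of n]
  proof eventually_elim
    case (elim z)
    define h where "h = 1 - z ^ n"
    have nz: "h \<noteq> 0" "1 - z \<noteq> 0"
      using elim n_def by (auto simp: h_def)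
    have "rhs_tail n z = (\<Sum>k=1..m. (h / (1 - z)) ^ 3 * (z ^ k * qpoch (z ^ 2) (z ^ 2) k
            / (qint z (2 * k) * qint z (2 * k - 1) * qpoch z (z ^ 2) k)))"
    proof -
      have "qint z n = h / (1 - z)" "(n - 1) div 2 = m"
        using elim by (simp_all add: h_def n_def qint_eq)
      then show ?thesis
        unfolding rhs_tail_def sum_distrib_left by (simp only:)
    qed
    also have "\<dots> = (\<Sum>l<m. (h / (1 - z)) ^ 3 * (z ^ Suc l * qpoch (z ^ 2) (z ^ 2) (Suc l)
            / (qint z (2 * Suc l) * qint z (2 * Suc l - 1) * qpoch z (z ^ 2) (Suc l))))"
      unfolding One_nat_def sum.atLeast1_atMost_eq ..
    also have "\<dots> = (\<Sum>l<m. h ^ 3 * T z l / (1 - z))"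
    proof (intro sum.cong refl)
      fix l
      have "(h / u) ^ 3 * (a / (b / u * (c / u) * d)) = h ^ 3 * (a / (b * c * d)) / u"
        if "u \<noteq> 0" for a b c d u :: complex
        using that by (simp add: power3_eq_cube divide_simps)
      then show "(h / (1 - z)) ^ 3 * (z ^ Suc l * qpoch (z ^ 2) (z ^ 2) (Suc l)
            / (qint z (2 * Suc l) * qint z (2 * Suc l - 1) * qpoch z (z ^ 2) (Suc l))) = h ^ 3 * T z l / (1 - z)"
        unfolding T_def using nz by (simp add: qint_eq)
    qed
    finally have tail: "rhs_tail n z = h ^ 3 * (\<Sum>l<m. T z l) / (1 - z)"
      by (simp add: sum_distrib_left sum_divide_distrib)
    have low: "lhs_fun m z = (wz_F z m m + (\<Sum>l<m. wz_G z (Suc m) (Suc l))) / (1 - z)"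
      using elim by (intro lhs_fun_lower) auto
    have "(F / u - R) / h3 + (G / h3 - S) / u = ((F + G) / u - (R + h3 * S / u)) / h3"
      if "h3 \<noteq> 0" "u \<noteq> 0" for F u R h3 G S :: complex
      using that by (simp add: divide_simps)
    then show ?case
      unfolding tail low sum_subtractf sum_divide_distrib [symmetric] h_def [symmetric] using nz by simp
  qed
  ultimately show ?thesis
    using tendsto_cong by fast
qed

lemma lhs_fun_full:
  fixes z :: complex
  assumes "z \<noteq> 1"
  shows "lhs_fun (2 * m) z = lhs_fun m z + (\<Sum>i<m. wz_F z (Suc m + i) 0) / (1 - z)"
proof -
  have "{0..2*m} = {0..m} \<union> {Suc m..<Suc m + m}" by auto
  then have "lhs_fun (2 * m) z = lhs_fun m z + (\<Sum>k\<in>{Suc m..<Suc m + m}. wz_F z k 0 / (1 - z))"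
    unfolding lhs_fun_def lhs_summand_wz [OF assms] by (simp only:) (rule sum.union_disjoint; auto)
  also have "(\<Sum>k\<in>{Suc m..<Suc m + m}. wz_F z k 0 / (1 - z)) = (\<Sum>i<m. wz_F z (Suc m + i) 0 / (1 - z))"
    by (rule sum.reindex_bij_witness [of _ "\<lambda>i. Suc m + i" "\<lambda>k. k - Suc m"]) auto
  finally show ?thesis by (simp add: sum_divide_distrib)
qed

lemma tendsto_primitive:
  assumes "N = m \<or> N = 2 * m"
  shows "((\<lambda>z. (lhs_fun N z - (rhs_main n z + rhs_tail n z)) / (1 - z ^ n) ^ 3) \<longlongrightarrow> 0) (at w)"
proof (cases "N = m")
  case False
  then have N: "N = 2 * m" using assms by simp
  have "((\<lambda>z. (lhs_fun m z - (rhs_main n z + rhs_tail n z)) / (1 - z ^ n) ^ 3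
      + (\<Sum>i<m. wz_F z (Suc m + i) 0 / (1 - z ^ n) ^ 3) / (1 - z)) \<longlongrightarrow> 0 + (\<Sum>i<m. upper_lim i) / (1 - w)) (at w)"
    by (intro tendsto_intros tendsto_lower tendsto_upper) auto
  then have "((\<lambda>z. (lhs_fun m z - (rhs_main n z + rhs_tail n z)) / (1 - z ^ n) ^ 3
      + (\<Sum>i<m. wz_F z (Suc m + i) 0 / (1 - z ^ n) ^ 3) / (1 - z)) \<longlongrightarrow> 0) (at w)"
    by (simp only: sum_upper_lim)  simp
  moreover have "\<forall>\<^sub>F z in at w. (lhs_fun m z - (rhs_main n z + rhs_tail n z)) / (1 - z ^ n) ^ 3
      + (\<Sum>i<m. wz_F z (Suc m + i) 0 / (1 - z ^ n) ^ 3) / (1 - z)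
      = (lhs_fun N z - (rhs_main n z + rhs_tail n z)) / (1 - z ^ n) ^ 3"
    using eventually_generic [of n]
  proof eventually_elim
    case (elim z)
    have "(a - b) / c + d / c / e = (a + d / e - b) / c" for a b c d e :: complex
      by (simp add: add_divide_distrib diff_divide_distrib mult.commute)
    moreover have "z \<noteq> 1" using elim by simp
    ultimately show ?case
      by (simp only: N lhs_fun_full sum_divide_distrib [symmetric] simp_thms)
  qed
  ultimately show ?thesis
    using tendsto_cong by fast
qed (use tendsto_lower in simp)

end

section \<open>Roots of unity of smaller order\<close>

lemma qpoch_add: "qpoch a q (i + j) = qpoch a q i * qpoch (a * q ^ i) q j"
proof (induction j)
  case (Suc j)
  then show ?case by (simp add: qpoch_def power_add mult_ac)
qed simp

lemma qint_1: "qint 1 k = of_nat k"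
  by (simp add: qint_def)

lemma sum_blocks:
  fixes g :: "nat \<Rightarrow> 'a::comm_monoid_add"
  shows "(\<Sum>k<n * f + s. g k) = (\<Sum>l<f. \<Sum>i<n. g (n * l + i)) + (\<Sum>i<s. g (n * f + i))"
proof -
  have split: "(\<Sum>k<a + b. g k) = (\<Sum>k<a. g k) + (\<Sum>i<b. g (a + i))" for a b
    by (induction b) (simp_all add: add.assoc)
  have "(\<Sum>k<n * f. g k) = (\<Sum>l<f. \<Sum>i<n. g (n * l + i))"
    by (induction f) (simp_all add: split add.commute [of n])
  then show ?thesis
    by (simp add: split)
qed

context odd_prim_root
begin

lemma power2_mult_n: "(w^2) ^ (n * l) = 1"
  by (metis power_mult power_one root mult.commute)

text \<open>After division by \<open>1 - z ^ n\<close> both parts are q-integers in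
  \<open>z ^ n\<close>, whose values at 1 are \<open>a\<close> and \<open>b\<close>.\<close>

lemma tendsto_quot_cyclo:
  assumes "b > 0"
  shows "((\<lambda>z. (1 - z ^ (n * a)) / (1 - z ^ (n * b))) \<longlongrightarrow> of_nat a / of_nat b) (at w)"
proof -
  have "((\<lambda>z. qint (z ^ n) a / qint (z ^ n) b) \<longlongrightarrow> qint (w ^ n) a / qint (w ^ n) b) (at w)"
    by (intro tendsto_intros) (use assms in \<open>simp add: root qint_1\<close>)
  moreover have "\<forall>\<^sub>F z in at w. qint (z ^ n) a / qint (z ^ n) b = (1 - z ^ (n * a)) / (1 - z ^ (n * b))"
    using eventually_h_nz by eventually_elim (simp add: qint_eq power_mult)
  ultimately have "((\<lambda>z. (1 - z ^ (n * a)) / (1 - z ^ (n * b))) \<longlongrightarrow> qint (w ^ n) a / qint (w ^ n) b) (at w)"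
    using tendsto_cong by fast
  then show ?thesis by (simp add: root qint_1)
qed

abbreviation qpoch_quot :: "complex \<Rightarrow> nat \<Rightarrow> complex" where
  "qpoch_quot z k \<equiv> qpoch z (z^2) k / qpoch (z^2) (z^2) k"

text \<open>Within a block of length \<open>n\<close> the only factor of the numerator vanishing at \<open>w\<close> is the middle one.\<close>

lemma odd_block:
  "qpoch z (z^2) (n * l + Suc m + i) = qpoch z (z^2) (n * l) * (qpoch (z * (z^2) ^ (n * l)) (z^2) m
    * (1 - z ^ (n * (2*l+1))) * qpoch (z * (z^2) ^ (n * l + Suc m)) (z^2) i)"
proof -
  have "z * (z^2) ^ (n * l) * (z^2) ^ m = z ^ (n * (2*l+1))"
    unfolding power_mult [symmetric] power_add [symmetric] power_Suc [symmetric]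
    by (rule arg_cong [of _ _ "power z"]) (simp add: n_def)
  moreover have "qpoch a q (Suc m) = qpoch a q m * (1 - a * q ^ m)" for a q :: 'a
    by (simp add: qpoch_def)
  ultimately show ?thesis
    unfolding qpoch_add [of _ _ "n * l + Suc m"] qpoch_add [of _ _ "n * l" "Suc m"] by (simp only: mult_ac)
qed

lemma odd_base: "w * (w^2) ^ (n * l) = w" "w * (w^2) ^ (n * l + Suc m) = w^2"
proof -
  show 1: "w * (w^2) ^ (n * l) = w" by (simp add: power2_mult_n)
  have "w * (w^2) ^ Suc m = w ^ (n + 2)"
    unfolding power_mult [symmetric] power_Suc [symmetric] by (rule arg_cong [of _ _ "power w"]) (simp add: n_def)
  then show "w * (w^2) ^ (n * l + Suc m) = w^2"
    by (simp only: power_add power2_mult_n mult_1 root)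
qed

text \<open>Each block contributes one vanishing factor above, \<open>1 - z ^ (n * (2*l+1))\<close>,
  and one below, \<open>1 - z ^ (n * (2*l+2))\<close>, so the zeros cancel. That the limit is
  nonzero allows the quotient to be inverted later.\<close>

lemma tendsto_quot_block: "\<exists>R. R \<noteq> 0 \<and> ((\<lambda>z. qpoch_quot z (n * l)) \<longlongrightarrow> R) (at w)"
proof (induction l)
  case 0
  show ?case by (intro exI [of _ 1]) simp
next
  case (Suc l)
  then obtain R where R: "R \<noteq> 0" "((\<lambda>z. qpoch_quot z (n * l)) \<longlongrightarrow> R) (at w)" by blast
  define L where "L = R * (qpoch (w * (w^2) ^ (n * l)) (w^2) m * qpoch (w * (w^2) ^ (n * l + Suc m)) (w^2) m
      / qpoch (w^2 * (w^2) ^ (n * l)) (w^2) (2 * m) * (of_nat (2*l+1) / of_nat (2*l+2)))"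
  have ez: "qpoch (w^2) (w^2) (2 * m) \<noteq> 0"
    by (rule even_nz) (simp add: n_def)
  have "((\<lambda>z. qpoch_quot z (n * l) * (qpoch (z * (z^2) ^ (n * l)) (z^2) m * qpoch (z * (z^2) ^ (n * l + Suc m)) (z^2) m
      / qpoch (z^2 * (z^2) ^ (n * l)) (z^2) (2 * m) * ((1 - z ^ (n * (2*l+1))) / (1 - z ^ (n * (2*l+2)))))) \<longlongrightarrow> L) (at w)"
    unfolding L_def
    using ez
    by (intro tendsto_mult [OF R(2)] tendsto_mult [OF _ tendsto_quot_cyclo] tendsto_intros) (simp_all only: power2_mult_n, simp_all)
  moreover have "(\<lambda>z. qpoch_quot z (n * l) * (qpoch (z * (z^2) ^ (n * l)) (z^2) m * qpoch (z * (z^2) ^ (n * l + Suc m)) (z^2) m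
      / qpoch (z^2 * (z^2) ^ (n * l)) (z^2) (2 * m) * ((1 - z ^ (n * (2*l+1))) / (1 - z ^ (n * (2*l+2)))))) = (\<lambda>z. qpoch_quot z (n * Suc l))"
  proof
    fix z :: complex
    have e: "n * Suc l = n * l + Suc m + m" "n * Suc l = Suc (n * l + 2 * m)" "2 * (n * l + 2 * m) + 2 = n * (2*l+2)"
      by (simp_all add: n_def)
    have "qpoch (z^2) (z^2) (n * Suc l) = qpoch (z^2) (z^2) (n * l) * qpoch (z^2 * (z^2) ^ (n * l)) (z^2) (2 * m) * (1 - z ^ (n * (2*l+2)))"
      unfolding e(2) qpoch_even_Suc e(3) qpoch_add ..
    moreover note odd_block [of z l m, folded e(1)]
    ultimately show "qpoch_quot z (n * l) * (qpoch (z * (z^2) ^ (n * l)) (z^2) m * qpoch (z * (z^2) ^ (n * l + Suc m)) (z^2) m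
      / qpoch (z^2 * (z^2) ^ (n * l)) (z^2) (2 * m) * ((1 - z ^ (n * (2*l+1))) / (1 - z ^ (n * (2*l+2))))) = qpoch_quot z (n * Suc l)"
      by (simp only: times_divide_times_eq mult_ac)
  qed
  moreover have "L \<noteq> 0"
    unfolding L_def odd_base power2_mult_n
    using R(1) odd_nz [of m] even_nz [of m] even_nz [of "2*m"]
    by (simp add: n_def del: of_nat_Suc of_nat_add)
  ultimately show ?case by auto
qed

text \<open>After full blocks the bases return to \<open>w\<close> and \<open>w^2\<close>, so the
  earlier blocks enter only through the constant \<open>R\<close>.\<close>

lemma tendsto_quot:
  assumes R: "((\<lambda>z. qpoch_quot z (n * l)) \<longlongrightarrow> R) (at w)" and "i < n"
  shows "((\<lambda>z. qpoch_quot z (n * l + i)) \<longlongrightarrow> R * qpoch_quot w i) (at w)"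
proof -
  have "((\<lambda>z. qpoch_quot z (n * l) * (qpoch (z * (z^2) ^ (n * l)) (z^2) i / qpoch (z^2 * (z^2) ^ (n * l)) (z^2) i)) \<longlongrightarrow>
      R * (qpoch (w * (w^2) ^ (n * l)) (w^2) i / qpoch (w^2 * (w^2) ^ (n * l)) (w^2) i)) (at w)"
    by (intro tendsto_intros R) (use even_nz [OF assms(2)] in \<open>simp add: power2_mult_n\<close>)
  then show ?thesis
    by (simp add: qpoch_add power2_mult_n)
qed

section \<open>The left-hand side at roots of smaller order\<close>

definition lhs_summand :: "complex \<Rightarrow> nat \<Rightarrow> complex" where
  "lhs_summand z k = (-1) ^ k * z ^ (k ^ 2) * qint z (4 * k + 1) * (qpoch z (z ^ 2) k ^ 3 / qpoch (z ^ 2) (z ^ 2) k ^ 3)"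

lemma lhs_fun_eq: "lhs_fun N z = (\<Sum>k<Suc N. lhs_summand z k)"
  by (simp only: lhs_fun_def lhs_summand_def atLeast0AtMost lessThan_Suc_atMost)

lemma odd_vanish:
  assumes "m < k"
  shows "qpoch w (w^2) k = 0"
proof -
  have "1 - w ^ (2*m+1) = 0" using root by (simp add: n_def)
  then show ?thesis using assms unfolding qpoch_odd_prod by (intro prod_zero) auto
qed

text \<open>The WZ identity holds at \<open>w\<close> itself, where the diagonal term and all
  boundary terms contain a vanishing odd factorial. The summands with \<open>m < k < n\<close> are
  zero for the same reason.\<close>

lemma sum_lhs_summand_root:
  assumes "s \<in> {Suc m, n}"
  shows "(\<Sum>i<s. lhs_summand w i) = 0"
proof -
  have "lhs_fun m w = (wz_F w m m + (\<Sum>l<m. wz_G w (Suc m) (Suc l))) / (1 - w)"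
    by (rule lhs_fun_lower) (use prim in auto)
  also have "\<dots> = 0"
    using m_pos by (simp add: wz_F_def wz_G_def odd_vanish)
  finally have "(\<Sum>i<Suc m. lhs_summand w i) = 0" by (simp only: lhs_fun_eq)
  moreover have "(\<Sum>i<n. lhs_summand w i) = (\<Sum>i<Suc m. lhs_summand w i)"
    by (rule sum.mono_neutral_right) (auto simp: lhs_summand_def odd_vanish n_def)
  ultimately show ?thesis using assms by auto
qed

text \<open>The sign, the cubed factorial quotient and the periodic powers of \<open>w\<close>
  separate the block number from the position in the block, so each block is proportional to the
  first.\<close>

lemma tendsto_lhs_block: "\<exists>c. \<forall>i<n. ((\<lambda>z. lhs_summand z (n * l + i)) \<longlongrightarrow> c * lhs_summand w i) (at w)"
proof -
  obtain R where R: "((\<lambda>z. qpoch_quot z (n * l)) \<longlongrightarrow> R) (at w)"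
    using tendsto_quot_block by blast
  have "((\<lambda>z. lhs_summand z (n * l + i)) \<longlongrightarrow> (-1) ^ (n * l) * R ^ 3 * lhs_summand w i) (at w)" if "i < n" for i
  proof -
    have "((\<lambda>z. (-1) ^ (n * l + i) * z ^ ((n * l + i)^2) * qint z (4 * (n * l + i) + 1) * qpoch_quot z (n * l + i) ^ 3) \<longlongrightarrow>
        (-1) ^ (n * l + i) * w ^ ((n * l + i)^2) * qint w (4 * (n * l + i) + 1) * (R * qpoch_quot w i) ^ 3) (at w)"
      by (intro tendsto_intros tendsto_quot R that)
    moreover have "w ^ ((n * l + i)^2) = w ^ (i^2)"
    proof -
      have "(n * l + i)^2 = n * (l * n * l + 2 * l * i) + i^2"
        by (simp add: power2_eq_square algebra_simps)
      then show ?thesis by (simp only: power_mod)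
    qed
    moreover have "qint w (4 * (n * l + i) + 1) = qint w (4 * i + 1)"
    proof -
      have "4 * (n * l + i) + 1 = n * (4 * l) + (4 * i + 1)" by simp
      then show ?thesis by (simp only: qint_eq [OF w_neq_1] power_mod)
    qed
    ultimately show ?thesis
      by (simp add: lhs_summand_def power_add power_mult_distrib power_divide mult_ac)
  qed
  then show ?thesis by blast
qed

text \<open>The sum up to \<open>N\<close> has \<open>Suc N\<close> terms: full blocks, possibly
  followed by the first \<open>m + 1\<close> terms of another block. Both kinds of partial sum
  vanish at \<open>w\<close>.\<close>

lemma tendsto_lhs_multiple:
  assumes "Suc N = n * f \<or> Suc N = n * f + Suc m"
  shows "(lhs_fun N \<longlongrightarrow> 0) (at w)"
proof -
  obtain s where s: "Suc N = n * f + s" "s = 0 \<or> s = Suc m"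
    using assms by auto
  obtain c where c: "((\<lambda>z. lhs_summand z (n * l + i)) \<longlongrightarrow> c l * lhs_summand w i) (at w)" if "i < n" for l i
    using tendsto_lhs_block by metis
  have "((\<lambda>z. lhs_fun N z) \<longlongrightarrow> (\<Sum>l<f. \<Sum>i<n. c l * lhs_summand w i) + (\<Sum>i<s. c f * lhs_summand w i)) (at w)"
    unfolding lhs_fun_eq s(1) sum_blocks
    by (intro tendsto_intros c) (use s(2) n_def in auto)
  also have "(\<Sum>l<f. \<Sum>i<n. c l * lhs_summand w i) + (\<Sum>i<s. c f * lhs_summand w i) = 0"
    unfolding sum_distrib_left [symmetric] using sum_lhs_summand_root [of n] sum_lhs_summand_root [of s] s(2)
    by auto
  finally show ?thesis .
qed

section \<open>The right-hand side at roots of smaller order\<close>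

lemma qint_multiple_root: "qint w (n * e) = 0"
  by (simp add: qint_eq power_mult root)

lemma tendsto_rhs_main_multiple: "(rhs_main (n * e) \<longlongrightarrow> 0) (at w)"
proof -
  have "(rhs_main (n * e) \<longlongrightarrow> rhs_main (n * e) w) (at w)"
    unfolding rhs_main_def by (intro tendsto_intros) auto
  then show ?thesis
    by (simp add: rhs_main_def qint_multiple_root)
qed

text \<open>Serves to spread the three factors \<open>qint z (n * e)\<close> of the tail over its
  possible poles: a factor that meets no pole tends to zero.\<close>

lemma tendsto_qint_quot:
  assumes "a > 0"
  obtains L where "((\<lambda>z. qint z (n * e) / qint z a) \<longlongrightarrow> L) (at w)" "\<not> n dvd a \<Longrightarrow> L = 0"
proof (cases "n dvd a")
  case True
  then obtain b where b: "a = n * b" by blast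
  have "\<forall>\<^sub>F z in at w. (1 - z ^ (n * e)) / (1 - z ^ (n * b)) = qint z (n * e) / qint z a"
    using eventually_generic [of 0] by eventually_elim (simp add: qint_eq b divide_simps)
  with tendsto_quot_cyclo [of b e] assms b
  have "((\<lambda>z. qint z (n * e) / qint z a) \<longlongrightarrow> of_nat e / of_nat b) (at w)"
    using tendsto_cong by fastforce
  then show ?thesis using that True by blast
next
  case False
  have "((\<lambda>z. qint z (n * e) / qint z a) \<longlongrightarrow> qint w (n * e) / qint w a) (at w)"
    by (intro tendsto_intros) (use power_neq_1 [OF False] in \<open>simp add: qint_eq\<close>)
  then show ?thesis using that by (simp add: qint_multiple_root)
qed

text \<open>The inverted quotient has at most a simple pole at \<open>w\<close>, arising from the
  middle factor of an incomplete block when \<open>k mod n > m\<close>; one q-integer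
  \<open>qint z (n * e)\<close> absorbs it.\<close>

lemma tendsto_inverse_quot: "\<exists>L. ((\<lambda>z. qint z (n * e) / qpoch_quot z k) \<longlongrightarrow> L) (at w)"
proof -
  define l i where "l = k div n" and "i = k mod n"
  have k: "k = n * l + i" by (simp add: l_def i_def)
  have i: "i < n" by (simp add: i_def n_def)
  obtain R where R: "R \<noteq> 0" "((\<lambda>z. qpoch_quot z (n * l)) \<longlongrightarrow> R) (at w)"
    using tendsto_quot_block by blast
  show ?thesis
  proof (cases "i \<le> m")
    case True
    have "((\<lambda>z. qint z (n * e) / qpoch_quot z (n * l + i)) \<longlongrightarrow> qint w (n * e) / (R * qpoch_quot w i)) (at w)"
      by (intro tendsto_intros tendsto_quot R i) (use R odd_nz [OF True] even_nz [OF i] in simp)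
    then show ?thesis unfolding k by blast
  next
    case False
    then obtain j where j: "i = Suc m + j"
      by (metis le_add_diff_inverse not_less_eq_eq)
    \<comment> \<open>The part of the incomplete block that stays finite and nonzero at
      \<open>w\<close>.\<close>
    define d where "d z = qpoch (z * (z^2) ^ (n * l)) (z^2) m * qpoch (z * (z^2) ^ (n * l + Suc m)) (z^2) j
        / qpoch (z^2 * (z^2) ^ (n * l)) (z^2) i" for z :: complex
    obtain L where L: "((\<lambda>z. qint z (n * e) / qint z (n * (2*l+1))) \<longlongrightarrow> L) (at w)"
      using tendsto_qint_quot [of "n * (2*l+1)" e] n_def by auto
    have "((\<lambda>z. qint z (n * e) / qint z (n * (2*l+1)) / ((1 - z) * (qpoch_quot z (n * l) * d z))) \<longlongrightarrow> L / ((1 - w) * (R * d w))) (at w)"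
      unfolding d_def
      by (intro tendsto_intros L R)
        (use R even_nz [OF i] odd_nz [of m] even_nz [of j] i j in \<open>simp_all only: odd_base power2_mult_n, simp_all\<close>)
    moreover have "\<forall>\<^sub>F z in at w. qint z (n * e) / qint z (n * (2*l+1)) / ((1 - z) * (qpoch_quot z (n * l) * d z))
        = qint z (n * e) / qpoch_quot z k"
      using eventually_generic [of 0]
    proof eventually_elim
      case (elim z)
      have "qpoch_quot z k = qpoch_quot z (n * l) * d z * (1 - z ^ (n * (2*l+1)))"
        unfolding k d_def qpoch_add [of "z^2" _ "n * l" i] unfolding j add.assoc [symmetric] odd_block
        by (simp add: mult_ac)
      also have "1 - z ^ (n * (2*l+1)) = (1 - z) * qint z (n * (2*l+1))"
        using elim by (simp add: qint_eq)
      finally show ?case by (simp add: mult_ac)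
    qed
    ultimately show ?thesis
      using tendsto_cong by fast
  qed
qed

text \<open>One factor \<open>qint z (n * e)\<close> goes to each of \<open>[2k]\<close>,
  \<open>[2k-1]\<close> and the factorial quotient. As \<open>n > 1\<close> cannot divide both
  \<open>2 * k\<close> and \<open>2 * k - 1\<close>, one of the first two quotients tends to zero
  while the others stay finite.\<close>

lemma tendsto_rhs_tail_multiple: "(rhs_tail (n * e) \<longlongrightarrow> 0) (at w)"
proof -
  have lim: "((\<lambda>z. qint z (n * e) ^ 3 * (z ^ k * qpoch (z ^ 2) (z ^ 2) k
            / (qint z (2 * k) * qint z (2 * k - 1) * qpoch z (z ^ 2) k))) \<longlongrightarrow> 0) (at w)" if k: "k > 0" for k
  proof -
    obtain L1 where L1: "((\<lambda>z. qint z (n * e) / qint z (2 * k)) \<longlongrightarrow> L1) (at w)" "\<not> n dvd 2 * k \<Longrightarrow> L1 = 0"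
      using tendsto_qint_quot [of "2 * k" e] k by auto
    obtain L2 where L2: "((\<lambda>z. qint z (n * e) / qint z (2 * k - 1)) \<longlongrightarrow> L2) (at w)" "\<not> n dvd 2 * k - 1 \<Longrightarrow> L2 = 0"
      using tendsto_qint_quot [of "2 * k - 1" e] k by auto
    obtain L3 where L3: "((\<lambda>z. qint z (n * e) / qpoch_quot z k) \<longlongrightarrow> L3) (at w)"
      using tendsto_inverse_quot by blast
    have "\<not> (n dvd 2 * k \<and> n dvd 2 * k - 1)"
    proof
      assume "n dvd 2 * k \<and> n dvd 2 * k - 1"
      moreover have "2 * k - (2 * k - 1) = 1" using k by simp
      ultimately have "n dvd 1" by (metis dvd_diff_nat)
      then show False using m_pos n_def by simp
    qed
    then have "L1 * L2 = 0" using L1(2) L2(2) by auto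
    moreover have "((\<lambda>z. z ^ k * ((qint z (n * e) / qint z (2 * k)) * (qint z (n * e) / qint z (2 * k - 1))) * (qint z (n * e) / qpoch_quot z k)) \<longlongrightarrow>
        w ^ k * (L1 * L2) * L3) (at w)"
      by (intro tendsto_intros L1 L2 L3)
    ultimately have "((\<lambda>z. z ^ k * ((qint z (n * e) / qint z (2 * k)) * (qint z (n * e) / qint z (2 * k - 1))) * (qint z (n * e) / qpoch_quot z k)) \<longlongrightarrow> 0) (at w)"
      by (simp only: mult_zero_left mult_zero_right)
    then show ?thesis
      by (simp add: power3_eq_cube mult_ac)
  qed
  have "((\<lambda>z. rhs_tail (n * e) z) \<longlongrightarrow> (\<Sum>k=1..(n * e - 1) div 2. 0)) (at w)"
    unfolding rhs_tail_def sum_distrib_left by (intro tendsto_sum lim) simp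
  then show ?thesis by simp
qed

end

section \<open>From limits to divisibility\<close>

lemma dvd_if_order_le:
  fixes p f :: "complex poly"
  assumes "p \<noteq> 0" "f \<noteq> 0" "\<And>w. order w p \<le> order w f"
  shows "p dvd f"
  using assms
proof (induction "degree p" arbitrary: p f)
  case 0
  then show ?case by (metis is_unit_iff_degree unit_imp_dvd)
next
  case (Suc k)
  then obtain w where w: "poly p w = 0"
    using fundamental_theorem_of_algebra [of p] by (metis constant_degree nat.distinct(1))
  then have "order w p \<noteq> 0"
    using Suc.prems(1) order_root by blast
  then have "poly f w = 0"
    using Suc.prems(3) [of w] order_root by fastforce
  from w this obtain p' f' where pf: "p = [:- w, 1:] * p'" "f = [:- w, 1:] * f'"
    by (auto simp: poly_eq_0_iff_dvd elim!: dvdE)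
  have nz: "p' \<noteq> 0" "f' \<noteq> 0" using Suc.prems pf by auto
  have "order a p' \<le> order a f'" for a
    using Suc.prems(3) [of a] order_mult [OF Suc.prems(1) [unfolded pf], of a]
      order_mult [OF Suc.prems(2) [unfolded pf], of a] unfolding pf by simp
  moreover have "k = degree p'"
  proof -
    have "degree p = degree [:- w, 1:] + degree p'"
      unfolding pf(1) by (rule degree_mult_eq) (use nz in auto)
    then show ?thesis using Suc.hyps(2) by simp
  qed
  ultimately have "p' dvd f'"
    using Suc.hyps(1) nz by blast
  then show ?case unfolding pf by (rule mult_dvd_mono [OF dvd_refl])
qed

lemma cpoly_eq_0_iff: "cpoly p = 0 \<longleftrightarrow> p = 0"
  using cpoly_inj [of p 0] by auto

text \<open>Division by a monic polynomial stays within the integers; the remainder is a complex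
  multiple of \<open>p\<close> of smaller degree, hence zero.\<close>

lemma dvd_if_cpoly_dvd:
  assumes "lead_coeff p = 1" "cpoly p dvd cpoly f"
  shows "p dvd f"
proof -
  have "p \<noteq> 0" using assms by auto
  obtain s r where sr: "pseudo_divmod f p = (s, r)"
    by fastforce
  have eq: "f = p * s + r" and r: "r = 0 \<or> degree r < degree p"
    using pseudo_divmod [OF \<open>p \<noteq> 0\<close> sr] assms(1) by simp_all
  have "cpoly p dvd cpoly r"
    using assms(2) unfolding eq cpoly_add cpoly_mult by (metis dvd_add_right_iff dvd_triv_left)
  have "r = 0"
  proof (rule ccontr)
    assume "r \<noteq> 0"
    then have "degree (cpoly p) \<le> degree (cpoly r)"
      using \<open>cpoly p dvd cpoly r\<close> by (intro dvd_imp_degree_le) (auto simp: cpoly_eq_0_iff)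
    then show False using r \<open>r \<noteq> 0\<close> by (simp add: degree_cpoly)
  qed
  then show ?thesis using eq by simp
qed

text \<open>The denominator \<open>g\<close> may vanish at \<open>w\<close>, which only strengthens
  the conclusion. The limit zero makes the inequality strict, and this extra order accounts for the
  factor \<open>[n]\<close> of the modulus.\<close>

lemma order_less_if_tendsto:
  fixes f g p :: "complex poly"
  assumes "f \<noteq> 0" "g \<noteq> 0" "p \<noteq> 0"
    and lim: "((\<lambda>z. poly f z / poly g z / poly p z) \<longlongrightarrow> 0) (at w)"
  shows "order w p < order w f"
proof (rule ccontr)
  define a b where "a = order w f" and "b = order w p"
  assume "\<not> order w p < order w f"
  then have ab: "a \<le> b" by (simp add: a_def b_def)
  obtain f1 where f1: "f = [:- w, 1:] ^ a * f1" "\<not> [:- w, 1:] dvd f1"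
    using order_decomp [OF \<open>f \<noteq> 0\<close>] a_def by blast
  obtain p1 where p1: "p = [:- w, 1:] ^ b * p1" "\<not> [:- w, 1:] dvd p1"
    using order_decomp [OF \<open>p \<noteq> 0\<close>] b_def by blast
  have nz: "poly f1 w \<noteq> 0" "poly p1 w \<noteq> 0"
    using f1(2) p1(2) by (simp_all add: poly_eq_0_iff_dvd)
  have "\<forall>\<^sub>F z in at w. z \<notin> {z. poly g z = 0} \<union> {w}"
    by (rule eventually_notin_finite) (use poly_roots_finite [OF \<open>g \<noteq> 0\<close>] in simp)
  then have "\<forall>\<^sub>F z in at w. poly f z / poly g z / poly p z * poly g z * (z - w) ^ (b - a) = poly f1 z / poly p1 z"
  proof eventually_elim
    case (elim z)
    have "(z - w) ^ b = (z - w) ^ (b - a) * (z - w) ^ a"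
      using ab by (simp flip: power_add)
    then show ?case using elim
      unfolding f1(1) p1(1) by (simp add: poly_power)
  qed
  moreover have "((\<lambda>z. poly f z / poly g z / poly p z * poly g z * (z - w) ^ (b - a)) \<longlongrightarrow> 0 * poly g w * (w - w) ^ (b - a)) (at w)"
    by (intro tendsto_intros lim)
  ultimately have "((\<lambda>z. poly f1 z / poly p1 z) \<longlongrightarrow> 0) (at w)"
    by (simp add: tendsto_cong)
  moreover have "((\<lambda>z. poly f1 z / poly p1 z) \<longlongrightarrow> poly f1 w / poly p1 w) (at w)"
    by (intro tendsto_intros nz)
  ultimately show False
    using LIM_unique nz by fastforce
qed

section \<open>Evaluation of rational functions near a point\<close>

definition eval_ratfun :: "ratfun \<Rightarrow> complex \<Rightarrow> complex" where
  "eval_ratfun x z = poly (cpoly (fst (quot_of_fract x))) z / poly (cpoly (snd (quot_of_fract x))) z"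

text \<open>Evaluation is a homomorphism only away from the poles, hence the restriction to a punctured neighbourhood.\<close>

definition represents :: "complex \<Rightarrow> ratfun \<Rightarrow> (complex \<Rightarrow> complex) \<Rightarrow> bool" where
  "represents w x F \<longleftrightarrow> (\<forall>\<^sub>F z in at w. F z = eval_ratfun x z)"

lemma eventually_cpoly_neq_0:
  assumes "p \<noteq> 0"
  shows "\<forall>\<^sub>F z in at w. poly (cpoly p) z \<noteq> 0"
  using eventually_notin_finite [OF poly_roots_finite [of "cpoly p"]] assms by (simp add: cpoly_eq_0_iff)

text \<open>The given and the reduced fraction agree wherever both denominators are nonzero, that
  is, off a finite set.\<close>

lemma represents_Fract:
  assumes "b \<noteq> 0"
  shows "represents w (Fract a b) (\<lambda>z. poly (cpoly a) z / poly (cpoly b) z)"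
proof -
  define c d where "c = fst (quot_of_fract (Fract a b))" and "d = snd (quot_of_fract (Fract a b))"
  have "d \<noteq> 0" by (simp add: d_def)
  have "Fract c d = Fract a b" by (simp add: c_def d_def)
  then have "c * b = a * d" using \<open>d \<noteq> 0\<close> assms by (simp add: eq_fract)
  then have eq: "poly (cpoly c) z * poly (cpoly b) z = poly (cpoly a) z * poly (cpoly d) z" for z
    by (metis cpoly_mult poly_mult)
  have "\<forall>\<^sub>F z in at w. poly (cpoly a) z / poly (cpoly b) z = poly (cpoly c) z / poly (cpoly d) z"
    using eventually_cpoly_neq_0 [OF assms] eventually_cpoly_neq_0 [OF \<open>d \<noteq> 0\<close>]
    by eventually_elim (use eq in \<open>simp add: frac_eq_eq mult.commute\<close>)
  then show ?thesis
    by (simp add: represents_def eval_ratfun_def c_def d_def)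
qed

lemma represents_cong:
  assumes "represents w x F" "\<forall>\<^sub>F z in at w. F z = G z"
  shows "represents w x G"
  using assms unfolding represents_def by eventually_elim simp

lemma represents_FractE:
  assumes "represents w x F"
  obtains a b where "x = Fract a b" "b \<noteq> 0" "\<forall>\<^sub>F z in at w. F z = poly (cpoly a) z / poly (cpoly b) z"
    "\<forall>\<^sub>F z in at w. poly (cpoly b) z \<noteq> 0"
  by (rule that [of "fst (quot_of_fract x)" "snd (quot_of_fract x)"])
    (use assms in \<open>simp_all add: represents_def eval_ratfun_def eventually_cpoly_neq_0\<close>)

lemma represents_add:
  assumes "represents w x F" "represents w y G"
  shows "represents w (x + y) (\<lambda>z. F z + G z)"
proof -
  obtain a b where x: "x = Fract a b" "b \<noteq> 0" and F: "\<forall>\<^sub>F z in at w. F z = poly (cpoly a) z / poly (cpoly b) z"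
    "\<forall>\<^sub>F z in at w. poly (cpoly b) z \<noteq> 0"
    using assms(1) by (rule represents_FractE)
  obtain c d where y: "y = Fract c d" "d \<noteq> 0" and G: "\<forall>\<^sub>F z in at w. G z = poly (cpoly c) z / poly (cpoly d) z"
    "\<forall>\<^sub>F z in at w. poly (cpoly d) z \<noteq> 0"
    using assms(2) by (rule represents_FractE)
  have "\<forall>\<^sub>F z in at w. poly (cpoly (a * d + c * b)) z / poly (cpoly (b * d)) z = F z + G z"
    using F G by eventually_elim (simp add: cpoly_add cpoly_mult add_frac_eq)
  then show ?thesis
    using represents_cong [OF represents_Fract] x y by simp
qed

lemma represents_mult:
  assumes "represents w x F" "represents w y G"
  shows "represents w (x * y) (\<lambda>z. F z * G z)"
proof -
  obtain a b where x: "x = Fract a b" "b \<noteq> 0" and F: "\<forall>\<^sub>F z in at w. F z = poly (cpoly a) z / poly (cpoly b) z"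
    "\<forall>\<^sub>F z in at w. poly (cpoly b) z \<noteq> 0"
    using assms(1) by (rule represents_FractE)
  obtain c d where y: "y = Fract c d" "d \<noteq> 0" and G: "\<forall>\<^sub>F z in at w. G z = poly (cpoly c) z / poly (cpoly d) z"
    "\<forall>\<^sub>F z in at w. poly (cpoly d) z \<noteq> 0"
    using assms(2) by (rule represents_FractE)
  have "\<forall>\<^sub>F z in at w. poly (cpoly (a * c)) z / poly (cpoly (b * d)) z = F z * G z"
    using F G by eventually_elim (simp add: cpoly_mult)
  then show ?thesis
    using represents_cong [OF represents_Fract] x y by simp
qed

text \<open>For \<open>x = 0\<close> both inverses are zero by convention, so quotients transfer to
  functions without side conditions.\<close>

lemma represents_inverse:
  assumes "represents w x F"
  shows "represents w (inverse x) (\<lambda>z. inverse (F z))"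
proof -
  obtain a b where x: "x = Fract a b" "b \<noteq> 0" and F: "\<forall>\<^sub>F z in at w. F z = poly (cpoly a) z / poly (cpoly b) z"
    "\<forall>\<^sub>F z in at w. poly (cpoly b) z \<noteq> 0"
    using assms by (rule represents_FractE)
  show ?thesis
  proof (cases "a = 0")
    case True
    then have "represents w (Fract 0 1) (\<lambda>z. inverse (F z))"
      using F by (intro represents_cong [OF represents_Fract]) (auto elim!: eventually_mono)
    then show ?thesis using True x by (simp add: fract_collapse)
  next
    case False
    then have "represents w (Fract b a) (\<lambda>z. inverse (F z))"
      using F by (intro represents_cong [OF represents_Fract]) (auto elim!: eventually_mono)
    then show ?thesis using x by simp
  qed
qed

lemma represents_0: "represents w 0 (\<lambda>z. 0)"
  by (simp add: represents_def eval_ratfun_def)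

lemma represents_1: "represents w 1 (\<lambda>z. 1)"
  by (simp add: represents_def eval_ratfun_def)

lemma represents_minus:
  assumes "represents w x F"
  shows "represents w (- x) (\<lambda>z. - F z)"
proof -
  have "represents w (Fract (-1) 1) (\<lambda>z. -1)"
    by (intro represents_cong [OF represents_Fract]) (auto simp: map_poly_pCons one_pCons)
  then have "represents w (Fract (-1) 1 * x) (\<lambda>z. -1 * F z)"
    by (rule represents_mult) (rule assms)
  moreover have "Fract (-1) 1 = (-1 :: ratfun)"
    by (metis One_fract_def minus_fract)
  ultimately show ?thesis by simp
qed

lemma represents_diff:
  "represents w x F \<Longrightarrow> represents w y G \<Longrightarrow> represents w (x - y) (\<lambda>z. F z - G z)"
  using represents_add [of w x F "- y" "\<lambda>z. - G z"] represents_minus [of w y G] by simp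

lemma represents_divide:
  "represents w x F \<Longrightarrow> represents w y G \<Longrightarrow> represents w (x / y) (\<lambda>z. F z / G z)"
  using represents_mult [of w x F "inverse y" "\<lambda>z. inverse (G z)"] represents_inverse [of w y G]
  by (simp add: divide_inverse)

lemma represents_power: "represents w x F \<Longrightarrow> represents w (x ^ k) (\<lambda>z. F z ^ k)"
  by (induction k) (simp_all add: represents_1 represents_mult)

lemma represents_power_int: "represents w x F \<Longrightarrow> represents w (x powi k) (\<lambda>z. F z powi k)"
  by (simp add: power_int_def represents_power represents_inverse)

lemma represents_sum:
  "(\<And>i. i \<in> I \<Longrightarrow> represents w (x i) (F i)) \<Longrightarrow> represents w (\<Sum>i\<in>I. x i) (\<lambda>z. \<Sum>i\<in>I. F i z)"
  by (induction I rule: infinite_finite_induct) (simp_all add: represents_0 represents_add)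

lemma represents_prod:
  "(\<And>i. i \<in> I \<Longrightarrow> represents w (x i) (F i)) \<Longrightarrow> represents w (\<Prod>i\<in>I. x i) (\<lambda>z. \<Prod>i\<in>I. F i z)"
  by (induction I rule: infinite_finite_induct) (simp_all add: represents_1 represents_mult)

lemma represents_of_nat: "represents w (of_nat k) (\<lambda>z. of_nat k)"
  by (induction k) (simp_all add: represents_0 represents_1 represents_add)

lemma represents_numeral: "represents w (numeral k) (\<lambda>z. numeral k)"
  using represents_of_nat [of w "numeral k"] by simp

lemma represents_qfun: "represents w qfun (\<lambda>z. z)"
  by (rule represents_cong [OF represents_Fract [of 1 w qpoly], folded to_fract_def])
    (simp_all add: map_poly_pCons)

lemma represents_qint: "represents w x F \<Longrightarrow> represents w (qint x k) (\<lambda>z. qint (F z) k)"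
  unfolding qint_def by (intro represents_sum represents_power)

lemma represents_qpoch:
  "represents w x F \<Longrightarrow> represents w y G \<Longrightarrow> represents w (qpoch x y k) (\<lambda>z. qpoch (F z) (G z) k)"
  unfolding qpoch_def by (intro represents_prod represents_diff represents_mult represents_power represents_1)

lemmas represents_intros = represents_sum represents_add represents_diff represents_minus represents_mult
  represents_divide represents_power represents_power_int represents_of_nat represents_numeral represents_1
  represents_qfun represents_qint represents_qpoch

lemma represents_lhs: "represents w (\<Sum>k=0..N. (-1) ^ k * qfun ^ (k ^ 2) * qint qfun (4 * k + 1)
        * (qpoch qfun (qfun ^ 2) k ^ 3 / qpoch (qfun ^ 2) (qfun ^ 2) k ^ 3)) (lhs_fun N)"
  unfolding lhs_fun_def by (intro represents_intros)

lemma represents_rhs: "represents w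
    ((-1) ^ ((n - 1) div 2) * qfun powi ((1 - int n ^ 2) div 4)
        * (qfun ^ (n choose 2) * qint qfun n
           + ((of_nat n ^ 2 - 1) * (1 - qfun) ^ 2 / 24) * qint qfun n ^ 3)
      + qint qfun n ^ 3
        * (\<Sum>k=1..(n - 1) div 2. qfun ^ k * qpoch (qfun ^ 2) (qfun ^ 2) k
            / (qint qfun (2 * k) * qint qfun (2 * k - 1) * qpoch qfun (qfun ^ 2) k)))
    (\<lambda>z. rhs_main n z + rhs_tail n z)"
  unfolding rhs_main_def rhs_tail_def by (intro represents_intros)

section \<open>Roots of cyclotomic polynomials and of q-integers\<close>

lemma cyclotomic_complex_dvd:
  assumes "n > 0"
  obtains q where "cyclotomic_complex n * q = monom 1 n - 1"
proof -
  have "cyclotomic_complex n dvd (\<Prod>d | d dvd n. cyclotomic_complex d)"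
    using assms by (intro dvd_prodI) auto
  then show ?thesis
    using that prod_cyclotomic_complex [OF assms] by (metis dvdE)
qed

text \<open>A root is a power of the standard root with exponent \<open>k\<close> coprime to
  \<open>n\<close>; \<open>w ^ d = 1\<close> would give \<open>n dvd k * d\<close>, hence
  \<open>n dvd d\<close>.\<close>

lemma cyclotomic_complex_root:
  assumes "poly (cyclotomic_complex n) w = 0" "n > 0" "0 < d" "d < n"
  shows "w ^ d \<noteq> 1"
proof
  assume "w ^ d = 1"
  obtain k where k: "k \<in> totatives n" "w = cis (2 * pi / real n) ^ k"
    using assms by (auto simp: cyclotomic_complex_def poly_prod)
  have cis: "cis (2 * pi / real n) ^ j = cis (2 * pi * real j / real n)" for j
    by (simp add: DeMoivre mult_ac)
  have period: "cis (2 * pi / real n) ^ n = 1"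
    using assms by (simp add: DeMoivre)
  have "cis (2 * pi / real n) ^ (k * d mod n) = cis (2 * pi / real n) ^ (n * (k * d div n) + k * d mod n)"
    by (simp only: power_add power_mult period) simp
  also have "\<dots> = 1"
    using \<open>w ^ d = 1\<close> by (simp add: k(2) power_mult)
  finally have "cis (2 * pi * real (k * d mod n) / real n) = cis (2 * pi * real 0 / real n)"
    by (simp add: cis)
  then have "k * d mod n = 0"
    using bij_betw_imp_inj_on [OF bij_betw_roots_unity [OF \<open>n > 0\<close>]] \<open>n > 0\<close>
    unfolding inj_on_def by (metis lessThan_iff mod_less_divisor)
  then have "n dvd k * d" by (simp add: dvd_eq_mod_eq_0)
  then have "n dvd d"
    using k(1) by (metis coprime_commute coprime_dvd_mult_right_iff in_totatives_iff)
  then show False using assms by (auto dest: dvd_imp_le)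
qed

text \<open>The derivative vanishes at most at 0, where the polynomial itself does not
  vanish.\<close>

lemma order_root_unity_le_1: "n > 0 \<Longrightarrow> order w (monom 1 n - 1 :: complex poly) \<le> 1"
proof -
  assume n: "n > 0"
  have "rsquarefree (monom 1 n - 1 :: complex poly)"
    unfolding rsquarefree_roots
  proof (intro allI notI, elim conjE)
    fix a :: complex
    assume "poly (monom 1 n - 1) a = 0" "poly (pderiv (monom 1 n - 1)) a = 0"
    then have "a ^ n = 1" "of_nat n * a ^ (n - 1) = 0"
      by (simp_all add: poly_monom pderiv_diff pderiv_monom)
    then show False using n by (auto simp: zero_power)
  qed
  then show ?thesis
    unfolding rsquarefree_def by (metis le_refl zero_le)
qed

lemma qint_mult: "qint (x :: 'a::comm_ring_1) n * (x - 1) = x ^ n - 1"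
  by (induction n) (simp_all add: qint_def algebra_simps)

lemma cpoly_qint: "cpoly (qint qpoly n) = qint [:0, 1:] n"
proof -
  have pow: "cpoly (qpoly ^ i) = [:0, 1:] ^ i" for i
    by (induction i) (simp_all add: cpoly_mult map_poly_pCons one_pCons)
  show ?thesis
    unfolding qint_def by (induction n) (simp_all add: cpoly_add pow)
qed

lemma poly_qint: "poly (qint p n) z = qint (poly p z) n"
  by (simp add: qint_def poly_sum poly_power)

lemma qint_X_mult: "qint [:0, 1:] n * [:-1, 1:] = (monom 1 n - 1 :: complex poly)"
proof -
  have "[:0, 1:] - 1 = ([:-1, 1:] :: complex poly)" "[:0, 1:] ^ n = (monom 1 n :: complex poly)"
    by (simp_all add: one_pCons monom_altdef)
  then show ?thesis
    using qint_mult [of "[:0, 1:] :: complex poly" n] by (simp only:)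
qed

text \<open>The excluded root \<open>1\<close> is harmless because neither factor of the modulus vanishes there.\<close>

lemma modulus_dvd:
  assumes "n > 1" and f: "f = fst (quot_of_fract x)" and F: "\<And>w. represents w x F"
    and lim: "\<And>w. w ^ n = 1 \<Longrightarrow> w \<noteq> 1 \<Longrightarrow> ((\<lambda>z. F z / poly (cyclotomic_complex n) z ^ 3) \<longlongrightarrow> 0) (at w)"
  shows "qint qpoly n * cyclotomic n ^ 3 dvd f"
proof (cases "f = 0")
  case False
  define g where "g = snd (quot_of_fract x)"
  have "g \<noteq> 0" by (simp add: g_def)
  let ?I = "qint [:0, 1:] n :: complex poly" and ?C = "cyclotomic_complex n"
  have lead_C: "lead_coeff ?C = 1" by (rule lead_coeff_cyclotomic_complex)
  have I: "?I * [:-1, 1:] = monom 1 n - 1" by (rule qint_X_mult)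
  have deg: "degree (monom 1 n - 1 :: complex poly) = n" "lead_coeff (monom 1 n - 1 :: complex poly) = 1"
  proof -
    show "degree (monom 1 n - 1 :: complex poly) = n"
      using assms(1) degree_add_eq_left [of "-1" "monom 1 n :: complex poly"] by (simp add: degree_monom_eq)
    then show "lead_coeff (monom 1 n - 1 :: complex poly) = 1"
      using assms(1) by (simp add: coeff_1)
  qed
  have lead_I: "lead_coeff ?I = 1"
    using arg_cong [OF I, of lead_coeff] deg(2) by (simp only: lead_coeff_mult) simp
  have nz: "?I \<noteq> 0" "?C \<noteq> 0" using lead_C lead_I by auto
  have eq: "cpoly (qint qpoly n * cyclotomic n ^ 3) = ?I * ?C ^ 3"
    by (simp add: cpoly_mult cpoly_qint map_poly_cyclotomic power3_eq_cube)
  have "cpoly (qint qpoly n * cyclotomic n ^ 3) dvd cpoly f"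
    unfolding eq
  proof (rule dvd_if_order_le)
    show "?I * ?C ^ 3 \<noteq> 0" using nz by simp
    show "cpoly f \<noteq> 0" using False by (simp add: cpoly_eq_0_iff)
    fix w
    show "order w (?I * ?C ^ 3) \<le> order w (cpoly f)"
    proof (cases "poly (?I * ?C ^ 3) w = 0")
      case True
      obtain q where q: "?C * q = monom 1 n - 1"
        by (rule cyclotomic_complex_dvd [of n]) (use assms(1) in simp)
      have root_I: "w ^ n = 1 \<and> w \<noteq> 1" if "poly ?I w = 0"
      proof -
        have "w ^ n - 1 = 0"
          using arg_cong [OF I, of "\<lambda>p. poly p w"] that by (simp add: poly_monom)
        moreover have "w \<noteq> 1" using that assms(1) by (auto simp: poly_qint qint_1)
        ultimately show ?thesis by simp
      qed
      have root_C: "w ^ n = 1 \<and> w \<noteq> 1" if "poly ?C w = 0"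
      proof -
        have "w ^ n - 1 = 0"
          using arg_cong [OF q, of "\<lambda>p. poly p w"] that by (simp add: poly_monom)
        moreover have "w \<noteq> 1" using cyclotomic_complex_root [OF that, of 1] assms(1) by auto
        ultimately show ?thesis by simp
      qed
      have w: "w ^ n = 1" "w \<noteq> 1"
        using True root_I root_C by auto
      have "\<forall>\<^sub>F z in at w. F z / poly ?C z ^ 3 = poly (cpoly f) z / poly (cpoly g) z / poly (?C ^ 3) z"
        using F [of w] unfolding represents_def by eventually_elim (simp add: eval_ratfun_def f g_def)
      then have "((\<lambda>z. poly (cpoly f) z / poly (cpoly g) z / poly (?C ^ 3) z) \<longlongrightarrow> 0) (at w)"
        using lim [OF w] tendsto_cong by fast
      \<comment> \<open>The strict inequality leaves room for one more zero, and \<open>?I\<close>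
        has only simple ones. This covers nonprimitive roots too, where \<open>?C\<close> has order
        zero.\<close>
      then have "order w (?C ^ 3) < order w (cpoly f)"
        using False \<open>g \<noteq> 0\<close> nz by (intro order_less_if_tendsto) (auto simp: cpoly_eq_0_iff)
      moreover have "order w ?I \<le> 1"
      proof -
        have "order w ?I + order w [:-1, 1:] = order w (monom 1 n - 1)"
          unfolding I [symmetric] by (rule order_mult [symmetric]) (use nz in \<open>simp only: mult_eq_0_iff, simp\<close>)
        also have "\<dots> \<le> 1" by (rule order_root_unity_le_1) (use assms(1) in simp)
        finally show ?thesis by simp
      qed
      ultimately show ?thesis
        using nz by (subst order_mult) auto
    next
      case False
      then show ?thesis using order_root [of "?I * ?C ^ 3" w] by auto
    qed
  qed
  \<comment> \<open>Being monic, the modulus also divides over the integers.\<close>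
  moreover have "lead_coeff (qint qpoly n * cyclotomic n ^ 3) = 1"
  proof -
    have "lead_coeff (cpoly (qint qpoly n * cyclotomic n ^ 3)) = 1"
      unfolding eq using lead_C lead_I by (simp add: lead_coeff_mult lead_coeff_power)
    then show ?thesis by (simp add: degree_cpoly coeff_map_poly)
  qed
  ultimately show ?thesis
    by (intro dvd_if_cpoly_dvd)
qed simp

section \<open>The limit at every nontrivial root, and the congruence\<close>

lemma obtain_primitive_order:
  fixes w :: complex
  assumes "w ^ n = 1" "n > 0" "w \<noteq> 1"
  obtains d where "d dvd n" "d > 1" "w ^ d = 1" "\<And>j. 0 < j \<Longrightarrow> j < d \<Longrightarrow> w ^ j \<noteq> 1"
proof -
  define d where "d = (LEAST d. 0 < d \<and> w ^ d = 1)"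
  have d: "0 < d \<and> w ^ d = 1"
    unfolding d_def using LeastI [of "\<lambda>d. 0 < d \<and> w ^ d = 1" n] assms by simp
  have least: "w ^ j \<noteq> 1" if "0 < j" "j < d" for j
    using that not_less_Least [of j "\<lambda>d. 0 < d \<and> w ^ d = 1"] by (auto simp: d_def)
  have "w ^ (n mod d) = w ^ (d * (n div d) + n mod d)"
    using d by (simp only: power_add power_mult) simp
  then have "w ^ (n mod d) = 1" using assms(1) by simp
  then have "n mod d = 0" using least [of "n mod d"] d by auto
  moreover have "d > 1" using d assms(3) by (cases "d = 1") auto
  ultimately show ?thesis using that d least by (metis dvd_eq_mod_eq_0)
qed

text \<open>Let \<open>d\<close> be the order of \<open>w\<close>. If \<open>d = n\<close>, then
  \<open>1 - z ^ n\<close> is a polynomial multiple of the cyclotomic polynomial, so the limit over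
  its cube carries over. If \<open>d < n\<close>, the cyclotomic polynomial is nonzero at
  \<open>w\<close>, and it suffices that each side tends to zero.\<close>

lemma tendsto_difference:
  assumes n: "n > 0" "odd n" and N: "N = (n - 1) div 2 \<or> N = n - 1"
    and w: "w ^ n = 1" "w \<noteq> 1"
  shows "((\<lambda>z. (lhs_fun N z - (rhs_main n z + rhs_tail n z)) / poly (cyclotomic_complex n) z ^ 3) \<longlongrightarrow> 0) (at w)"
proof -
  obtain d where d: "d dvd n" "d > 1" "w ^ d = 1" "\<And>j. 0 < j \<Longrightarrow> j < d \<Longrightarrow> w ^ j \<noteq> 1"
    using obtain_primitive_order [OF w(1) n(1) w(2)] by blast
  have "odd d" using d(1) n(2) dvd_trans by blast
  then obtain m where m: "d = 2 * m + 1" by (auto elim: oddE)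
  interpret odd_prim_root m d w
  proof
    show "d = 2 * m + 1" by (fact m)
    show "m > 0" using d(2) m by simp
    show "w ^ d = 1" by (fact d(3))
    show "w ^ j \<noteq> 1" if "0 < j" "j < d" for j using d(4) that .
  qed
  obtain e where e: "n = d * e" using d(1) by blast
  show ?thesis
  proof (cases "e = 1")
    case True
    then have nd: "n = d" using e by simp
    obtain q where q: "cyclotomic_complex n * q = monom 1 n - 1"
      using cyclotomic_complex_dvd n(1) by blast
    have q_eval: "1 - z ^ n = - (poly (cyclotomic_complex n) z * poly q z)" for z
      using arg_cong [OF q, of "\<lambda>p. poly p z"] by (simp add: poly_monom)
    have "N = m \<or> N = 2 * m" using N m nd by simp
    then have L: "((\<lambda>z. (lhs_fun N z - (rhs_main n z + rhs_tail n z)) / (1 - z ^ n) ^ 3) \<longlongrightarrow> 0) (at w)"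
      unfolding nd by (rule tendsto_primitive)
    have "((\<lambda>z. (lhs_fun N z - (rhs_main n z + rhs_tail n z)) / (1 - z ^ n) ^ 3 * (- poly q z) ^ 3) \<longlongrightarrow> 0 * (- poly q w) ^ 3) (at w)"
      by (intro tendsto_mult tendsto_power tendsto_minus tendsto_poly tendsto_ident_at L)
    then have "((\<lambda>z. (lhs_fun N z - (rhs_main n z + rhs_tail n z)) / (1 - z ^ n) ^ 3 * (- poly q z) ^ 3) \<longlongrightarrow> 0) (at w)"
      by (simp only: mult_zero_left)
    moreover have "\<forall>\<^sub>F z in at w. (lhs_fun N z - (rhs_main n z + rhs_tail n z)) / (1 - z ^ n) ^ 3 * (- poly q z) ^ 3
        = (lhs_fun N z - (rhs_main n z + rhs_tail n z)) / poly (cyclotomic_complex n) z ^ 3"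
      using eventually_power_neq_1 [OF n(1)]
    proof eventually_elim
      case (elim z)
      define c r where "c = poly (cyclotomic_complex n) z" and "r = poly q z"
      have h: "1 - z ^ n = - (c * r)" using q_eval [of z] by (simp add: c_def r_def)
      then have "c \<noteq> 0" "r \<noteq> 0" using elim by auto
      then show ?case
        unfolding h c_def [symmetric] r_def [symmetric] by (simp add: power3_eq_cube)
    qed
    ultimately show ?thesis
      using tendsto_cong by fast
  next
    case False
    have "odd e" using n(2) e by simp
    then obtain f where f: "e = 2 * f + 1" by (auto elim: oddE)
    have "d < n" using e False n(1) d(2) by (metis d(1) dvd_imp_le le_neq_implies_less mult.right_neutral mult_cancel1 neq0_conv)
    then have C: "poly (cyclotomic_complex n) w \<noteq> 0"
      using cyclotomic_complex_root [of n w d] d(2,3) n(1) by force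
    \<comment> \<open>From \<open>n = d * (2 * f + 1)\<close> and \<open>d = 2 * m + 1\<close>
      follows \<open>(n - 1) / 2 = d * f + m\<close>: \<open>f\<close> full blocks and the first
      half of the next.\<close>
    have "Suc N = d * e \<or> Suc N = d * f + Suc m"
      using N
    proof
      assume "N = (n - 1) div 2"
      moreover have "n - 1 = 2 * (d * f + m)" by (simp add: e f m algebra_simps)
      ultimately show ?thesis by simp
    qed (use e n(1) in simp)
    then have L: "(lhs_fun N \<longlongrightarrow> 0) (at w)"
      using tendsto_lhs_multiple by blast
    have "((\<lambda>z. (lhs_fun N z - (rhs_main n z + rhs_tail n z)) / poly (cyclotomic_complex n) z ^ 3) \<longlongrightarrow>
        (0 - (0 + 0)) / poly (cyclotomic_complex n) w ^ 3) (at w)"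
    proof (intro tendsto_divide tendsto_diff tendsto_add tendsto_power L)
      show "(rhs_main n \<longlongrightarrow> 0) (at w)" "(rhs_tail n \<longlongrightarrow> 0) (at w)"
        unfolding e by (rule tendsto_rhs_main_multiple tendsto_rhs_tail_multiple)+
      show "(poly (cyclotomic_complex n) \<longlongrightarrow> poly (cyclotomic_complex n) w) (at w)"
        by (rule tendsto_poly [OF tendsto_ident_at])
      show "poly (cyclotomic_complex n) w ^ 3 \<noteq> 0" using C by simp
    qed
    then show ?thesis by simp
  qed
qed

theorem theorem1p1:
  fixes n N :: nat
  assumes "n > 0" and "odd n"
    and "N = (n - 1) div 2 \<or> N = n - 1"
  shows "ratfun_cong
    (\<Sum>k=0..N. (-1) ^ k * qfun ^ (k ^ 2) * qint qfun (4 * k + 1)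
        * (qpoch qfun (qfun ^ 2) k ^ 3 / qpoch (qfun ^ 2) (qfun ^ 2) k ^ 3))
    ((-1) ^ ((n - 1) div 2) * qfun powi ((1 - int n ^ 2) div 4)
        * (qfun ^ (n choose 2) * qint qfun n
           + ((of_nat n ^ 2 - 1) * (1 - qfun) ^ 2 / 24) * qint qfun n ^ 3)
      + qint qfun n ^ 3
        * (\<Sum>k=1..(n - 1) div 2. qfun ^ k * qpoch (qfun ^ 2) (qfun ^ 2) k
            / (qint qfun (2 * k) * qint qfun (2 * k - 1) * qpoch qfun (qfun ^ 2) k)))
    (qint qpoly n * cyclotomic n ^ 3)"
proof (cases "n = 1")
  case True
  \<comment> \<open>For \<open>n = 1\<close> the modulus does vanish at 1, so this case is separate;
    both sides are equal to 1.\<close>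
  then have "N = 0" using assms(3) by auto
  have "qfun powi ((1 - int n ^ 2) div 4) = 1" "n choose 2 = 0" "(n - 1) div 2 = 0"
    using True by simp_all
  then show ?thesis
    unfolding ratfun_cong_def \<open>N = 0\<close> using True by (simp add: qint_def binomial_eq_0)
next
  case False
  then have "n > 1" using assms(1) by simp
  show ?thesis
    unfolding ratfun_cong_def
    by (rule modulus_dvd [OF \<open>n > 1\<close> refl represents_diff [OF represents_lhs represents_rhs]])
      (rule tendsto_difference [OF assms])
qed

end
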